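(* Consider the bifurcating autoregressive (BAR) model and assume that the distribution $\nu$ of the ancestor $X_1$ has finite moments of all orders. Let $\mu$ be the unique stationary distribution of the induced Markov chain $(Y_r,r\in\mathbb N)$. Then: (i) almost surely, for any $f\in C_{\mathrm{pol}}(\mathbb R)$, $\overline M_{\mathbb G_q}(f)$ (as $q\to\infty$) and $\overline M_{\mathbb T_r}(f)$ (as $r\to\infty$) converge to $(\mu,f)$; (ii) almost surely, for any $f\in C_{\mathrm{pol}}(\mathbb R^3)$, $\overline M_{\mathbb G_q}(f)$ and $\overline M_{\mathbb T_r}(f)$ converge to $(\mu,Pf)$. (In both cases the almost sure event does not depend on $f$.)
   Context: Tree. $\mathbb T=\mathbb N^*=\{1,2,\dots\}$ is the binary tree (vertex $n$ has daughters $2n$, $2n+1$); $\mathbb G_q=\{2^q,\dots,2^{q+1}-1\}$; $\mathbb T_r=\bigcup_{q=0}^r\mathbb G_q$. BAR model. $X_1$ has distribution $\nu$ on $\mathbb R$ and for all $n\ge1$, $$X_{2n}=\alpha_0X_n+\beta_0+\varepsilon_{2n},\qquad X_{2n+1}=\alpha_1X_n+\beta_1+\varepsilon_{2n+1},$$ where $\alpha_0,\alpha_1\in(-1,1)$, $\beta_0,\beta_1\in\mathbb R$, and $((\varepsilon_{2n},\varepsilon_{2n+1}),n\ge1)$ is a sequence, independent of $X_1$, of i.i.d. centered bivariate Gaussian vectors with covariance matrix $\sigma^2\begin{pmatrix}1&\rho\\\rho&1\end{pmatrix}$, $\sigma^2>0$, $\rho\in(-1,1)$. $P(x,\cdot)$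 denotes the law $\mathcal N_2\big((\alpha_0x+\beta_0,\alpha_1x+\beta_1),\sigma^2\begin{pmatrix}1&\rho\\\rho&1\end{pmatrix}\big)$, i.e. the conditional law of $(X_{2n},X_{2n+1})$ given $X_n=x$. Induced chain. $(Y_r,r\in\mathbb N)$ is the real Markov chain with $Y_0=X_1$ and $Y_{r+1}=X_{2n+\zeta_{r+1}}$ if $Y_r=X_n$, with $(\zeta_q)_{q\ge1}$ i.i.d. uniform on $\{0,1\}$, independent of $X$. Its transition probability is $Q(x,\cdot)=\tfrac12\mathcal N(\alpha_0x+\beta_0,\sigma^2)+\tfrac12\mathcal N(\alpha_1x+\beta_1,\sigma^2)$; it has a unique stationary distribution. Function spaces. $C_{\mathrm{pol}}(\mathbb R^p)$ is the set of continuous functions $f:\mathbb R^p\to\mathbb R$ bounded in absolute value by $c(1+\|x\|^m)$ for some $c\ge0$, $m\in\mathbb N$. For $f\in C_{\mathrm{pol}}(\mathbb R^3)$, $Pf(x)=\int_{\mathbb R^2}f(x,y,z)P(x,dy\,dz)$. $(\mu,g)=\int g\,d\mu$. Averages. $\Delta_i=(X_i,X_{2i},X_{2i+1})$. For finite $I\subset\mathbb T$: $\overline M_I(f)=|I|^{-1}\sum_{i\in I}f(X_i)$ if $f$ is defined on $\mathbb R$, and $|I|^{-1}\sum_{i\in I}f(\Delta_i)$ if $f$ is defined on $\mathbb R^3$. *)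

theory Defs
  imports "HOL-Probability.Probability"
begin

definition generation :: "nat \<Rightarrow> nat set" where
  "generation q = {2 ^ q .. 2 ^ (q + 1) - 1}"

definition tree_upto :: "nat \<Rightarrow> nat set" where
  "tree_upto r = (\<Union>q\<in>{0..r}. generation q)"

definition C_pol :: "('v::euclidean_space \<Rightarrow> real) set" where
  "C_pol = {f. continuous_on UNIV f \<and>
     (\<exists>c\<ge>0. \<exists>m::nat. \<forall>x. \<bar>f x\<bar> \<le> c * (1 + norm x ^ m))}"

definition gauss :: "real \<Rightarrow> real \<Rightarrow> real measure" where
  "gauss m \<sigma> = density lborel (\<lambda>x. ennreal (normal_density m \<sigma> x))"

text \<open>
  Density of the Gaussian law on the plane with mean \<open>(a, b)\<close>, common variance \<open>\<sigma>\<^sup>2\<close> and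
  correlation \<open>\<rho>\<close>. The covariance matrix has determinant \<open>\<sigma>\<^sup>4 (1 - \<rho>\<^sup>2)\<close>, and the exponent is
  minus one half of its inverse quadratic form at \<open>(y - a, z - b)\<close>. The formula is meant for
  \<open>\<sigma> > 0\<close> and \<open>-1 < \<rho> < 1\<close>, where the matrix is invertible.
\<close>

definition normal2_density ::
  "real \<Rightarrow> real \<Rightarrow> real \<Rightarrow> real \<Rightarrow> real \<times> real \<Rightarrow> real" where
  "normal2_density a b \<sigma> \<rho> = (\<lambda>(y, z).
     1 / (2 * pi * \<sigma>\<^sup>2 * sqrt (1 - \<rho>\<^sup>2)) *
     exp (- ((y - a)\<^sup>2 - 2 * \<rho> * (y - a) * (z - b) + (z - b)\<^sup>2) / (2 * \<sigma>\<^sup>2 * (1 - \<rho>\<^sup>2))))"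

definition gauss2 :: "real \<Rightarrow> real \<Rightarrow> real \<Rightarrow> real \<Rightarrow> (real \<times> real) measure" where
  "gauss2 a b \<sigma> \<rho> = density lborel (\<lambda>p. ennreal (normal2_density a b \<sigma> \<rho> p))"

text \<open>
  \<open>X 0\<close>, \<open>\<epsilon> 0\<close> and \<open>\<epsilon> 1\<close> play no role: the tree starts at vertex 1 and the noise at index 2.
  The last assumption is independence of \<open>X 1\<close> and the whole noise sequence, stated through the
  generated sigma-algebras because \<open>indep_var\<close> requires both variables to have the same type.
\<close>

locale bar_model = prob_space M
  for M :: "'a measure"
    and X :: "nat \<Rightarrow> 'a \<Rightarrow> real"
    and \<epsilon> :: "nat \<Rightarrow> 'a \<Rightarrow> real"
    and \<nu> :: "real measure"
    and \<alpha>0 \<beta>0 \<alpha>1 \<beta>1 \<sigma> \<rho> :: real +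
  assumes alpha0: "\<alpha>0 \<in> {-1<..<1}"
    and alpha1: "\<alpha>1 \<in> {-1<..<1}"
    and sigma: "\<sigma> > 0"
    and rho: "\<rho> \<in> {-1<..<1}"
    and X1_rv: "random_variable borel (X 1)"
    and X1_distr: "distr M borel (X 1) = \<nu>"
    and X_even: "\<And>n \<omega>. n \<ge> 1 \<Longrightarrow> \<omega> \<in> space M \<Longrightarrow>
          X (2 * n) \<omega> = \<alpha>0 * X n \<omega> + \<beta>0 + \<epsilon> (2 * n) \<omega>"
    and X_odd: "\<And>n \<omega>. n \<ge> 1 \<Longrightarrow> \<omega> \<in> space M \<Longrightarrow>
          X (2 * n + 1) \<omega> = \<alpha>1 * X n \<omega> + \<beta>1 + \<epsilon> (2 * n + 1) \<omega>"
    and noise_distr: "\<And>n. n \<ge> 1 \<Longrightarrow>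
          distr M borel (\<lambda>\<omega>. (\<epsilon> (2 * n) \<omega>, \<epsilon> (2 * n + 1) \<omega>)) = gauss2 0 0 \<sigma> \<rho>"
    and noise_indep: "indep_vars (\<lambda>_. borel)
          (\<lambda>n \<omega>. (\<epsilon> (2 * n) \<omega>, \<epsilon> (2 * n + 1) \<omega>)) {1..}"
    and noise_indep_X1: "indep_set
          (sets (vimage_algebra (space M) (X 1) borel))
          (sets (vimage_algebra (space M)
            (\<lambda>\<omega>. \<lambda>n\<in>{1..}. (\<epsilon> (2 * n) \<omega>, \<epsilon> (2 * n + 1) \<omega>)) (Pi\<^sub>M {1..} (\<lambda>_. borel))))"

definition bar_P ::
  "real \<Rightarrow> real \<Rightarrow> real \<Rightarrow> real \<Rightarrow> real \<Rightarrow> real \<Rightarrow> real \<Rightarrow> (real \<times> real) measure" where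
  "bar_P \<alpha>0 \<beta>0 \<alpha>1 \<beta>1 \<sigma> \<rho> x = gauss2 (\<alpha>0 * x + \<beta>0) (\<alpha>1 * x + \<beta>1) \<sigma> \<rho>"

definition kernel_op ::
  "(real \<Rightarrow> (real \<times> real) measure) \<Rightarrow> (real \<times> real \<times> real \<Rightarrow> real) \<Rightarrow> real \<Rightarrow> real" where
  "kernel_op P f x = (\<integral>(y, z). f (x, y, z) \<partial>P x)"

definition bar_Q ::
  "real \<Rightarrow> real \<Rightarrow> real \<Rightarrow> real \<Rightarrow> real \<Rightarrow> real \<Rightarrow> real set \<Rightarrow> ennreal" where
  "bar_Q \<alpha>0 \<beta>0 \<alpha>1 \<beta>1 \<sigma> x A =
     (1 / 2) * emeasure (gauss (\<alpha>0 * x + \<beta>0) \<sigma>) A +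
     (1 / 2) * emeasure (gauss (\<alpha>1 * x + \<beta>1) \<sigma>) A"

definition stationary_distribution ::
  "(real \<Rightarrow> real set \<Rightarrow> ennreal) \<Rightarrow> real measure \<Rightarrow> bool" where
  "stationary_distribution Q \<mu> \<longleftrightarrow> prob_space \<mu> \<and> sets \<mu> = sets borel \<and>
     (\<forall>A\<in>sets borel. (\<integral>\<^sup>+x. Q x A \<partial>\<mu>) = emeasure \<mu> A)"

definition average :: "nat set \<Rightarrow> ('v \<Rightarrow> real) \<Rightarrow> (nat \<Rightarrow> 'v) \<Rightarrow> real" where
  "average I f Z = (\<Sum>i\<in>I. f (Z i)) / real (card I)"

definition mother_daughters :: "(nat \<Rightarrow> 'a \<Rightarrow> real) \<Rightarrow> 'a \<Rightarrow> nat \<Rightarrow> real \<times> real \<times> real" where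
  "mother_daughters X \<omega> i = (X i \<omega>, X (2 * i) \<omega>, X (2 * i + 1) \<omega>)"

end

theory Submission
  imports Defs
begin

text \<open>
  Let \<open>F (x, p)\<close> be centred in the noise \<open>p\<close> and dominated by a square integrable function of \<open>p\<close>.
  Within one generation the variables \<open>F (X i, noise i)\<close> are orthogonal, because \<open>noise i\<close> is
  independent of everything else in the generation; hence the second moment of their mean over
  generation \<open>q\<close> is \<open>O(2\<^sup>-\<^sup>q)\<close>, which is summable, and the mean tends to 0 almost surely. Two
  consequences follow. With \<open>F\<close> a function of the noise alone, the pathwise bound
  \<open>\<bar>X (2 i)\<bar>\<^sup>k \<le> r \<bar>X i\<bar>\<^sup>k + C N(noise i)\<close>, \<open>r < 1\<close>, makes the empirical moments of the generations
  bounded almost surely. With \<open>F\<close> the deviation of a function of a family from its conditional mean,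
  the average of \<open>g\<close> over generation \<open>q + k\<close> is asymptotically that of \<open>Q\<^sup>k g\<close> over generation \<open>q\<close>.
  For Lipschitz \<open>g\<close> the function \<open>Q\<^sup>k g\<close> has Lipschitz constant \<open>O(r\<^sup>k)\<close>, so it is close to the
  constant \<open>\<integral> g d\<mu>\<close>. Finally a countable family of bounded Lipschitz functions approximates
  every nonnegative continuous function from below, and the moment bounds upgrade the convergence
  to all of \<open>C_pol\<close>, with one exceptional null set.
\<close>

section \<open>Averages over generations and trees\<close>

text \<open>The test function is chosen after the outcome, so everything random must be settled by
  countably many almost sure statements: convergence along a countable family and one moment bound
  per exponent. What remains is deterministic, for a fixed sequence of points. No moment of
  \<open>\<mu>\<close> is given: the integrability of functions of polynomial growth is inherited
  from the bounded empirical moments by an inequality of Fatou type. The passage to polynomial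
  growth is made only for families; a function of one vertex is a function of the mother, whose
  conditional mean is the function itself, so (i) becomes an instance of the statement on families.
  The two daughters may be correlated, hence their noise is kept together as one unit, indexed by
  the mother; invariance of \<open>\<mu>\<close> involves only the two equal marginals of this pair.
  Trees need no probability: their averages are weighted means of generation averages in which the
  last few generations dominate.\<close>

lemma affine_recursion_bound:
  fixes m :: "nat \<Rightarrow> real"
  assumes "\<And>q. m (Suc q) \<le> a * m q + c" and "0 \<le> a" "a < 1" "0 \<le> c" "0 \<le> m 0"
  shows "m q \<le> m 0 + c / (1 - a)"
proof (induction q)
  case 0
  then show ?case using assms by simp
next
  case (Suc q)
  have "m (Suc q) \<le> a * (m 0 + c / (1 - a)) + c"
    using assms(1)[of q] mult_left_mono[OF Suc assms(2)] by linarith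
  also have "\<dots> = a * m 0 + c / (1 - a)"
    using assms(3) by (simp add: field_simps)
  also have "\<dots> \<le> m 0 + c / (1 - a)"
    using assms mult_left_le_one_le[of "m 0" a] by simp
  finally show ?case .
qed

text \<open>The weighted mean \<open>c\<close> satisfies
  \<open>c (Suc r) = c r / 2 + b (Suc r)\<close>: each step halves the memory of the past, so only
  recent terms of \<open>b\<close> count.\<close>

lemma dyadic_weighted_mean_tendsto_0:
  fixes b :: "nat \<Rightarrow> real"
  assumes "b \<longlonglongrightarrow> 0"
  shows "(\<lambda>r. (\<Sum>q\<le>r. 2 ^ q * b q) / 2 ^ r) \<longlonglongrightarrow> 0"
proof (rule LIMSEQ_I)
  fix e :: real assume "e > 0"
  define c where "c r = (\<Sum>q\<le>r. 2 ^ q * b q) / 2 ^ r" for r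
  have c_Suc: "c (Suc r) = c r / 2 + b (Suc r)" for r
    by (simp add: c_def field_simps)
  \<comment> \<open>With increments below e/4 the level e/2 is reproduced by the recursion: (e/2)/2
    + e/4 = e/2.\<close>
  obtain N where N: "\<And>q. q \<ge> N \<Longrightarrow> \<bar>b q\<bar> < e / 4"
    using LIMSEQ_D[OF assms, of "e / 4"] \<open>e > 0\<close> by auto
  have bound: "\<bar>c (N + k)\<bar> \<le> \<bar>c N\<bar> / 2 ^ k + e / 2" for k
  proof (induction k)
    case 0
    then show ?case using \<open>e > 0\<close> by simp
  next
    case (Suc k)
    have "\<bar>c (N + Suc k)\<bar> \<le> \<bar>c (N + k)\<bar> / 2 + \<bar>b (Suc (N + k))\<bar>"
      using c_Suc[of "N + k"] by simp
    also have "\<dots> \<le> (\<bar>c N\<bar> / 2 ^ k + e / 2) / 2 + e / 4"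
      using Suc N[of "Suc (N + k)"] by (intro add_mono divide_right_mono) simp_all
    finally show ?case by (simp add: field_simps)
  qed
  have "(\<lambda>k. \<bar>c N\<bar> * (1 / 2) ^ k) \<longlonglongrightarrow> \<bar>c N\<bar> * 0"
    by (intro tendsto_intros LIMSEQ_power_zero) simp
  from LIMSEQ_D[OF this, of "e / 2"] obtain K where K: "\<And>k. k \<ge> K \<Longrightarrow> \<bar>c N\<bar> / 2 ^ k < e / 2"
    using \<open>e > 0\<close> by (auto simp: power_divide)
  have "\<bar>c r\<bar> < e" if "r \<ge> N + K" for r
  proof -
    have "\<bar>c r\<bar> \<le> \<bar>c N\<bar> / 2 ^ (r - N) + e / 2"
      using bound[of "r - N"] that by simp
    moreover have "\<bar>c N\<bar> / 2 ^ (r - N) < e / 2"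
      using that by (intro K) simp
    ultimately show ?thesis by linarith
  qed
  then show "\<exists>no. \<forall>n\<ge>no. norm ((\<Sum>q\<le>n. 2 ^ q * b q) / 2 ^ n - 0) < e"
    unfolding c_def by (intro exI[of _ "N + K"]) simp
qed

section \<open>Generations and trees as index sets\<close>

lemma finite_generation [simp]: "finite (generation q)"
  by (simp add: generation_def)

lemma card_generation [simp]: "card (generation q) = 2 ^ q"
  by (simp add: generation_def)

lemma generation_iff: "i \<in> generation q \<longleftrightarrow> 2 ^ q \<le> i \<and> i < 2 ^ (q + 1)"
proof -
  have "(0::nat) < 2 ^ (q + 1)" by simp
  then have "i \<le> 2 ^ (q + 1) - 1 \<longleftrightarrow> i < 2 ^ (q + 1)" by linarith
  then show ?thesis unfolding generation_def by simp
qed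

lemma generation_ge_1: "i \<in> generation q \<Longrightarrow> 1 \<le> i"
  by (auto simp: generation_def intro: order_trans[rotated])

lemma sum_generation_Suc:
  "(\<Sum>i\<in>generation (Suc q). h i) = (\<Sum>i\<in>generation q. h (2 * i) + h (2 * i + 1))"
  for h :: "nat \<Rightarrow> real"
proof -
  have eq: "generation (Suc q) = (\<lambda>i. 2 * i) ` generation q \<union> (\<lambda>i. 2 * i + 1) ` generation q"
    (is "_ = ?A \<union> ?B")
  proof (intro equalityI subsetI)
    fix j assume "j \<in> generation (Suc q)"
    then have "j div 2 \<in> generation q"
      by (auto simp: generation_def)
    moreover have "j = 2 * (j div 2) \<or> j = 2 * (j div 2) + 1"
      by presburger
    ultimately show "j \<in> ?A \<union> ?B" by blast
  next
    fix j assume "j \<in> ?A \<union> ?B"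
    then show "j \<in> generation (Suc q)"
      by (auto simp: generation_iff)
  qed
  have "?A \<inter> ?B = {}"
    by (auto, presburger)
  then have "(\<Sum>i\<in>generation (Suc q). h i) = sum h ?A + sum h ?B"
    unfolding eq by (intro sum.union_disjoint) auto
  also have "sum h ?A = (\<Sum>i\<in>generation q. h (2 * i))"
    by (subst sum.reindex) (auto simp: inj_on_def)
  also have "sum h ?B = (\<Sum>i\<in>generation q. h (2 * i + 1))"
    by (subst sum.reindex) (auto simp: inj_on_def)
  finally show ?thesis by (simp add: sum.distrib)
qed

lemma generation_disjoint: "q \<noteq> r \<Longrightarrow> generation q \<inter> generation r = {}"
proof (induction q r rule: linorder_wlog)
  case (le a b)
  then have "(2::nat) ^ (a + 1) \<le> 2 ^ b" by (intro power_increasing) auto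
  then show ?case by (auto simp: generation_def)
qed auto

lemma average_generation:
  "average (generation q) f Z = (\<Sum>i\<in>generation q. f (Z i)) / 2 ^ q"
  by (simp add: average_def)

lemma average_tree_upto:
  "average (tree_upto r) f Z =
     (\<Sum>q\<le>r. 2 ^ q * average (generation q) f Z) / (2 ^ (r + 1) - 1)"
proof -
  have "(\<Sum>i\<in>tree_upto r. f (Z i)) = (\<Sum>q\<le>r. \<Sum>i\<in>generation q. f (Z i))"
    unfolding tree_upto_def atLeast0AtMost
    by (intro sum.UNION_disjoint) (auto dest: generation_disjoint)
  moreover have "card (tree_upto r) = (\<Sum>q\<le>r. 2 ^ q)"
    unfolding tree_upto_def atLeast0AtMost
    by (subst card_UN_disjoint) (auto dest: generation_disjoint)
  then have "real (card (tree_upto r)) = 2 ^ (r + 1) - 1"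
    by (simp add: sum_power2 flip: atLeast0AtMost)
       (simp add: atLeast0AtMost lessThan_Suc_atMost[symmetric] geometric_sum flip: of_nat_sum)
  ultimately show ?thesis
    by (simp add: average_def)
qed

text \<open>Subtracting \<open>l\<close> from every generation leaves a dyadic weighted mean of a
  null sequence. The tree has 2^(r+1) - 1 vertices, at least the 2^r by which that mean is
  normalized, so comparison suffices.\<close>

lemma average_tree_upto_tendsto:
  assumes "(\<lambda>q. average (generation q) f Z) \<longlonglongrightarrow> l"
  shows "(\<lambda>r. average (tree_upto r) f Z) \<longlonglongrightarrow> l"
proof -
  define b where "b q = average (generation q) f Z - l" for q
  have sum2: "(\<Sum>q\<le>r. (2::real) ^ q) = 2 ^ (r + 1) - 1" for r
    by (simp add: lessThan_Suc_atMost[symmetric] geometric_sum)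
  have pos: "(2::real) ^ (r + 1) - 1 \<ge> 2 ^ r" for r
    by simp
  have "b \<longlonglongrightarrow> 0"
    using tendsto_diff[OF assms tendsto_const[of l]] by (simp add: b_def[abs_def])
  note lim = dyadic_weighted_mean_tendsto_0[OF this]
  have eq: "average (tree_upto r) f Z - l = (\<Sum>q\<le>r. 2 ^ q * b q) / (2 ^ (r + 1) - 1)" for r
  proof -
    have "(2::real) ^ (r + 1) - 1 \<noteq> 0" using pos[of r] zero_less_power[of "2::real" r] by linarith
    moreover have "(\<Sum>q\<le>r. 2 ^ q * b q)
        = (\<Sum>q\<le>r. 2 ^ q * average (generation q) f Z) - (2 ^ (r + 1) - 1) * l"
      unfolding sum2[symmetric]
      by (simp add: b_def right_diff_distrib sum_subtractf sum_distrib_right)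
    ultimately show ?thesis
      by (simp add: average_tree_upto diff_divide_distrib)
  qed
  have "(\<lambda>r. average (tree_upto r) f Z - l) \<longlonglongrightarrow> 0"
  proof (rule Lim_null_comparison[OF _ tendsto_rabs_zero[OF lim]], intro always_eventually allI)
    fix r
    show "norm (average (tree_upto r) f Z - l) \<le> \<bar>(\<Sum>q\<le>r. 2 ^ q * b q) / 2 ^ r\<bar>"
      unfolding eq real_norm_def abs_divide
    proof (intro divide_left_mono)
      show "\<bar>2 ^ r\<bar> \<le> \<bar>(2::real) ^ (r + 1) - 1\<bar>"
        using pos[of r] zero_less_power[of "2::real" r] by linarith
      show "0 < \<bar>(2::real) ^ (r + 1) - 1\<bar> * \<bar>2 ^ r\<bar>"
        using pos[of r] zero_less_power[of "2::real" r] by (intro mult_pos_pos) linarith+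
    qed simp
  qed
  then show ?thesis by (simp add: LIM_zero_iff)
qed

section \<open>From Lipschitz test functions to polynomial growth\<close>

definition bounded_lipschitz :: "('v::metric_space \<Rightarrow> real) \<Rightarrow> bool" where
  "bounded_lipschitz f \<longleftrightarrow> (\<exists>B. \<forall>x. \<bar>f x\<bar> \<le> B) \<and> (\<exists>L\<ge>0. \<forall>x y. \<bar>f x - f y\<bar> \<le> L * dist x y)"

lemma bounded_lipschitz_continuous:
  assumes "bounded_lipschitz f"
  shows "continuous_on UNIV f"
proof -
  obtain L where "L \<ge> 0" "\<And>x y. \<bar>f x - f y\<bar> \<le> L * dist x y"
    using assms by (auto simp: bounded_lipschitz_def)
  then have "L-lipschitz_on UNIV f"
    by (intro lipschitz_onI) (auto simp: dist_real_def)
  then show ?thesis by (rule lipschitz_on_continuous_on)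
qed

lemma bounded_lipschitz_measurable:
  "bounded_lipschitz f \<Longrightarrow> f \<in> borel_measurable borel"
  by (intro borel_measurable_continuous_onI bounded_lipschitz_continuous)

lemma bounded_lipschitz_const: "bounded_lipschitz (\<lambda>x. c)"
  unfolding bounded_lipschitz_def by (intro conjI exI[of _ "\<bar>c\<bar>"] exI[of _ 0]) simp_all

lemma bounded_lipschitz_max:
  assumes "bounded_lipschitz f" "bounded_lipschitz g"
  shows "bounded_lipschitz (\<lambda>x. max (f x) (g x))"
proof -
  obtain B L B' L' where f: "\<And>x. \<bar>f x\<bar> \<le> B" "L \<ge> 0" "\<And>x y. \<bar>f x - f y\<bar> \<le> L * dist x y"
    and g: "\<And>x. \<bar>g x\<bar> \<le> B'" "L' \<ge> 0" "\<And>x y. \<bar>g x - g y\<bar> \<le> L' * dist x y"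
    using assms by (auto simp: bounded_lipschitz_def)
  have "\<bar>max (f x) (g x)\<bar> \<le> max B B'" for x
    using f(1)[of x] g(1)[of x] by linarith
  moreover have "\<bar>max (f x) (g x) - max (f y) (g y)\<bar> \<le> max L L' * dist x y" for x y
  proof -
    have "L * dist x y \<le> max L L' * dist x y" "L' * dist x y \<le> max L L' * dist x y"
      by (auto intro!: mult_right_mono)
    then show ?thesis
      using f(3)[of x y] g(3)[of x y] by linarith
  qed
  ultimately show ?thesis
    unfolding bounded_lipschitz_def using f(2) by (meson max.coboundedI1)
qed

text \<open>A tent with apex \<open>c\<close>, height \<open>s\<close> (when positive) and slope
  \<open>r\<close>, cut off at zero. Its three parameters can be restricted to countable sets, which
  is how a countable family arises.\<close>

definition cone :: "'v::metric_space \<Rightarrow> real \<Rightarrow> real \<Rightarrow> 'v \<Rightarrow> real" where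
  "cone c r s x = max 0 (s - r * dist x c)"

lemma bounded_lipschitz_cone:
  assumes "r \<ge> 0"
  shows "bounded_lipschitz (cone c r s)"
proof -
  have "\<bar>cone c r s x\<bar> \<le> \<bar>s\<bar>" for x
    using mult_nonneg_nonneg[OF assms zero_le_dist[of x c]] by (auto simp: cone_def)
  moreover have "\<bar>cone c r s x - cone c r s y\<bar> \<le> r * dist x y" for x y
  proof -
    have "\<bar>r * dist x c - r * dist y c\<bar> = r * \<bar>dist x c - dist y c\<bar>"
      using assms by (simp add: abs_mult flip: right_diff_distrib)
    also have "\<dots> \<le> r * dist x y"
      using assms abs_dist_diff_le[of x c y] by (intro mult_left_mono) (auto simp: dist_commute)
    finally show ?thesis by (auto simp: cone_def)
  qed
  ultimately show ?thesis
    using assms unfolding bounded_lipschitz_def by blast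
qed

text \<open>Near \<open>x\<close> the function exceeds a rational height \<open>s\<close> above
  \<open>u\<close>. A cone of height \<open>s\<close> steep enough to vanish outside that
  neighbourhood lies below \<open>f\<close>, and moving its centre slightly into \<open>D\<close>
  lowers its value at \<open>x\<close> by less than \<open>s - u\<close>.\<close>

lemma cone_below_continuous:
  fixes f :: "'v::metric_space \<Rightarrow> real"
  assumes D: "\<And>X. open X \<Longrightarrow> X \<noteq> {} \<Longrightarrow> \<exists>d\<in>D. d \<in> X"
    and f: "continuous_on UNIV f" "\<And>y. 0 \<le> f y" and u: "0 \<le> u" "u < f x"
  obtains c r s where "c \<in> D" "\<And>y. cone c (real r) (real_of_rat s) y \<le> f y"
    "u < cone c (real r) (real_of_rat s) x"
proof -
  obtain s where s: "u < real_of_rat s" "real_of_rat s < f x"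
    using of_rat_dense[OF u(2)] by blast
  define t where "t = real_of_rat s"
  have "open {y. t < f y}"
    using f(1) by (intro open_Collect_less continuous_on_const)
  then obtain d where d: "d > 0" "\<And>y. dist y x < d \<Longrightarrow> t < f y"
    using s unfolding open_dist t_def by blast
  \<comment> \<open>Points at distance at least \<open>d\<close> from \<open>x\<close> are at
    distance at least \<open>d / 2\<close> from the centre, so this slope brings the cone down to 0
    there.\<close>
  obtain r :: nat where r: "2 * t / d < r" "r > 0"
    using reals_Archimedean2[of "max 0 (2 * t / d)"] by auto
  \<comment> \<open>The first bound keeps the centre within \<open>d / 2\<close> of
    \<open>x\<close>; the second keeps the loss \<open>r * dist x c\<close> below
    \<open>t - u\<close>.\<close>
  define e where "e = min (d / 2) ((t - u) / r)"
  have "e > 0" using d r s by (auto simp: e_def t_def)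
  then obtain c where c: "c \<in> D" "c \<in> ball x e"
    using D[of "ball x e"] by auto
  have "cone c r t y \<le> f y" for y
  proof (cases "dist y x < d")
    case True
    moreover have "0 \<le> real r * dist y c" by simp
    ultimately show ?thesis using d(2)[of y] f(2)[of y] unfolding cone_def by linarith
  next
    case False
    have "dist y x \<le> dist y c + dist x c" by (rule dist_triangle2)
    then have "dist y c \<ge> d / 2" using False c by (auto simp: e_def)
    then have "r * (d / 2) \<le> r * dist y c" by (intro mult_left_mono) auto
    moreover have "t < r * (d / 2)" using r d by (simp add: field_simps)
    ultimately show ?thesis using f(2)[of y] by (simp add: cone_def)
  qed
  moreover have "u < cone c r t x"
  proof -
    have "r * dist x c < r * ((t - u) / r)"
      using c r by (intro mult_strict_left_mono) (auto simp: e_def)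
    then show ?thesis using r by (simp add: cone_def)
  qed
  ultimately show ?thesis using that c by (auto simp: t_def)
qed

text \<open>Finite maxima of cones with centres in a countable dense set and rational parameters form
  a countable family that approximates every nonnegative continuous function from below.\<close>

lemma countable_approximation_from_below:
  "\<exists>h :: nat \<Rightarrow> 'v::{metric_space,second_countable_topology} \<Rightarrow> real.
    (\<forall>k. bounded_lipschitz (h k)) \<and> (\<forall>k x. 0 \<le> h k x) \<and>
    (\<forall>f. continuous_on UNIV f \<longrightarrow> (\<forall>x. 0 \<le> f x) \<longrightarrow>
       (\<exists>j::nat \<Rightarrow> nat. \<forall>x. incseq (\<lambda>n. h (j n) x) \<and> (\<lambda>n. h (j n) x) \<longlonglongrightarrow> f x))"
proof -
  obtain D :: "'v set" where D: "countable D" "\<And>X. open X \<Longrightarrow> X \<noteq> {} \<Longrightarrow> \<exists>d\<in>D. d \<in> X"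
    by (rule countable_dense_setE) blast
  define \<phi> where "\<phi> = (\<lambda>(i, r, s). cone (from_nat_into D i) (real (r::nat)) (real_of_rat s))"
  \<comment> \<open>The fold starts from 0, so even the empty list gives a nonnegative
    function.\<close>
  define H where "H ts x = foldr (\<lambda>t. max (\<phi> t x)) ts 0" for ts x
  have H_ge: "t \<in> set ts \<Longrightarrow> \<phi> t x \<le> H ts x" for t ts x
    unfolding H_def by (induction ts) (auto simp: le_max_iff_disj)
  have H_le: "\<lbrakk>0 \<le> u; \<And>t. t \<in> set ts \<Longrightarrow> \<phi> t x \<le> u\<rbrakk> \<Longrightarrow> H ts x \<le> u" for ts x u
    unfolding H_def by (induction ts) auto
  have H_nonneg: "0 \<le> H ts x" for ts x
    unfolding H_def by (induction ts) (auto simp: le_max_iff_disj)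
  have "bounded_lipschitz (H ts)" for ts
  proof (induction ts)
    case Nil
    then show ?case by (simp add: H_def bounded_lipschitz_const)
  next
    case (Cons t ts)
    have "bounded_lipschitz (\<phi> t)"
      by (cases t) (simp add: \<phi>_def bounded_lipschitz_cone)
    from bounded_lipschitz_max[OF this Cons] show ?case
      by (simp add: H_def)
  qed
  moreover have "\<exists>j::nat \<Rightarrow> nat. \<forall>x. incseq (\<lambda>n. H (from_nat (j n)) x)
      \<and> (\<lambda>n. H (from_nat (j n)) x) \<longlonglongrightarrow> f x"
    if f: "continuous_on UNIV f" "\<And>x. 0 \<le> f x" for f :: "'v \<Rightarrow> real"
  proof -
    \<comment> \<open>Among the first \<open>n\<close> coded cones those below \<open>f\<close> are
      kept. The lists grow with \<open>n\<close>, so their maxima increase; the maxima stay below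
      \<open>f\<close> and eventually include any cone found by
      \<open>cone_below_continuous\<close>.\<close>
    define ts where "ts n = filter (\<lambda>t. \<forall>x. \<phi> t x \<le> f x) (map from_nat [0..<n])" for n
    have inc: "incseq (\<lambda>n. H (ts n) x)" for x
      by (intro monoI H_le H_nonneg H_ge) (auto simp: ts_def intro!: imageI)
    have le: "H (ts n) x \<le> f x" for n x
      by (intro H_le f) (auto simp: ts_def)
    have "(\<lambda>n. H (ts n) x) \<longlonglongrightarrow> f x" for x
    proof (rule increasing_tendsto)
      fix u assume "u < f x"
      show "\<forall>\<^sub>F n in sequentially. u < H (ts n) x"
      proof (cases "u < 0")
        case True
        then have "u < H (ts n) x" for n using H_nonneg[of "ts n" x] by linarith
        then show ?thesis by simp
      next
        case False
        then obtain c r s where c: "c \<in> D" "\<And>y. cone c (real r) (real_of_rat s) y \<le> f y"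
            "u < cone c (real r) (real_of_rat s) x"
          using cone_below_continuous[OF D(2) f, of u x] \<open>u < f x\<close> by auto
        obtain i where i: "from_nat_into D i = c"
          using from_nat_into_surj[OF D(1) c(1)] by blast
        define k where "k = to_nat (i, r, s)"
        have "(i, r, s) \<in> set (ts n)" if "n > k" for n
          using that c(2) by (auto simp: ts_def \<phi>_def i k_def image_iff intro!: bexI[of _ k])
        then have "u < H (ts n) x" if "n > k" for n
          using that H_ge[of "(i, r, s)" "ts n" x] c(3) by (force simp: \<phi>_def i)
        then show ?thesis
          by (auto simp: eventually_sequentially intro!: exI[of _ "Suc k"])
      qed
    qed (simp add: le)
    with inc show ?thesis
      by (intro exI[of _ "\<lambda>n. to_nat (ts n)"]) simp
  qed
  ultimately show ?thesis
    using H_nonneg by (intro exI[of _ "\<lambda>k. H (from_nat k)"] conjI allI impI) simp_all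
qed

section \<open>Averages converging to integrals\<close>

lemma average_mono:
  "(\<And>x. f x \<le> g x) \<Longrightarrow> average I f Z \<le> average I g Z"
  unfolding average_def by (intro divide_right_mono sum_mono) auto

lemma average_add: "average I (\<lambda>x. f x + g x) Z = average I f Z + average I g Z"
  by (simp add: average_def sum.distrib add_divide_distrib)

lemma average_cmult: "average I (\<lambda>x. c * f x) Z = c * average I f Z"
  by (simp add: average_def sum_distrib_left)

lemma average_const: "finite I \<Longrightarrow> I \<noteq> {} \<Longrightarrow> average I (\<lambda>x. c) Z = c"
  by (simp add: average_def)

text \<open>A one-sided weak convergence argument: lower semicontinuity for nonnegative continuous
  functions only uses the approximation from below, and it is applied to
  \<open>f + e w\<^sup>2 + c\<^sup>2 / (4 e)\<close>, which is nonnegative when \<open>\<bar>f\<bar> \<le> c w\<close>.\<close>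

locale converging_averages =
  fixes I :: "nat \<Rightarrow> nat set" and Z :: "nat \<Rightarrow> 'v::euclidean_space" and T :: "'v measure"
    and h :: "nat \<Rightarrow> 'v \<Rightarrow> real"
  assumes I: "\<And>q. finite (I q)" "\<And>q. I q \<noteq> {}"
    and T: "prob_space T" "sets T = sets borel"
    and h: "\<And>k. bounded_lipschitz (h k)" "\<And>k x. 0 \<le> h k x"
    and h_approx: "\<And>f. continuous_on UNIV f \<Longrightarrow> (\<And>x. 0 \<le> f x) \<Longrightarrow>
       \<exists>j::nat \<Rightarrow> nat. \<forall>x. incseq (\<lambda>n. h (j n) x) \<and> (\<lambda>n. h (j n) x) \<longlonglongrightarrow> f x"
    and h_tendsto: "\<And>k. (\<lambda>q. average (I q) (h k) Z) \<longlonglongrightarrow> (\<integral>x. h k x \<partial>T)"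
    and norm_bound: "\<And>m::nat. \<exists>K. \<forall>q. average (I q) (\<lambda>x. norm x ^ m) Z \<le> K"
begin

interpretation T: prob_space T by (rule T)

lemma continuous_T_measurable:
  "continuous_on UNIV f \<Longrightarrow> f \<in> borel_measurable T" for f :: "'v \<Rightarrow> real"
  using borel_measurable_continuous_onI[of f] by (simp cong: measurable_cong_sets add: T(2))

lemma h_integrable: "integrable T (h k)"
proof -
  obtain B where "\<And>x. \<bar>h k x\<bar> \<le> B"
    using h(1)[of k] by (auto simp: bounded_lipschitz_def)
  then show ?thesis
    using continuous_T_measurable[OF bounded_lipschitz_continuous[OF h(1)]]
    by (intro T.integrable_const_bound[of _ B]) auto
qed

text \<open>Fatou's inequality for the averages. Integrability of \<open>g\<close> is a conclusion:
  the bound \<open>K\<close> on the averages passes to the integrals of the minorants and from there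
  to \<open>g\<close>.\<close>

lemma nonneg_continuous:
  assumes g: "continuous_on UNIV g" "\<And>x. 0 \<le> g x" and K: "\<And>q. average (I q) g Z \<le> K"
  shows "integrable T g"
    and "e > 0 \<Longrightarrow> \<forall>\<^sub>F q in sequentially. (\<integral>x. g x \<partial>T) - e < average (I q) g Z"
proof -
  obtain j where j: "\<And>x. incseq (\<lambda>n. h (j n) x)" "\<And>x. (\<lambda>n. h (j n) x) \<longlonglongrightarrow> g x"
    using h_approx[OF g] by blast
  have h_le: "h (j n) x \<le> g x" for n x
    using incseq_le[OF j(1) j(2)] by blast
  \<comment> \<open>Only \<open>q\<close> tends to infinity here, with the minorant fixed; monotone
    convergence in \<open>n\<close> comes afterwards, so limits are never interchanged.\<close>
  have int_le: "(\<integral>x. h (j n) x \<partial>T) \<le> K" for n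
  proof (rule LIMSEQ_le_const2[OF h_tendsto], intro exI allI impI)
    fix q
    show "average (I q) (h (j n)) Z \<le> K"
      using average_mono[of "h (j n)" g "I q" Z] h_le K[of q] by (meson order_trans)
  qed
  have inc: "incseq (\<lambda>n. \<integral>x. h (j n) x \<partial>T)"
    using j(1) by (intro monoI integral_mono h_integrable) (auto simp: incseq_def)
  obtain L where L: "(\<lambda>n. \<integral>x. h (j n) x \<partial>T) \<longlonglongrightarrow> L"
    using incseq_convergent[OF inc] int_le by blast
  note mc = integral_monotone_convergence_nonneg[of T "\<lambda>n. h (j n)" g L]
  have mono: "AE x in T. mono (\<lambda>n. h (j n) x)" using j(1) by simp
  show "integrable T g"
    using h_integrable mono h(2) j(2) L continuous_T_measurable[OF g(1)] by (intro mc(1)) auto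
  have "integral\<^sup>L T g = L"
    using h_integrable mono h(2) j(2) L continuous_T_measurable[OF g(1)] by (intro mc(2)) auto
  assume "e > 0"
  then have "\<forall>\<^sub>F n in sequentially. L - e < (\<integral>x. h (j n) x \<partial>T)"
    using order_tendstoD(1)[OF L, of "L - e"] by simp
  then obtain n where n: "L - e < (\<integral>x. h (j n) x \<partial>T)"
    by (auto simp: eventually_sequentially)
  show "\<forall>\<^sub>F q in sequentially. (\<integral>x. g x \<partial>T) - e < average (I q) g Z"
    using order_tendstoD(1)[OF h_tendsto n]
  proof eventually_elim
    case (elim q)
    then show ?case
      using average_mono[of "h (j n)" g "I q" Z] h_le \<open>integral\<^sup>L T g = L\<close> by force
  qed
qed

lemma weight_bound:
  "\<exists>K\<ge>0. \<forall>q. average (I q) (\<lambda>x. (1 + norm x ^ m)\<^sup>2) Z \<le> K"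
proof -
  obtain K where K: "\<And>q. average (I q) (\<lambda>x. norm x ^ (m * 2)) Z \<le> K"
    using norm_bound[of "m * 2"] by auto
  have young: "(1 + t)\<^sup>2 \<le> 2 + 2 * t\<^sup>2" for t :: real
    using zero_le_power2[of "1 - t"] by (simp add: power2_eq_square algebra_simps)
  have avg_le: "average (I q) (\<lambda>x. (1 + norm x ^ m)\<^sup>2) Z \<le> 2 + 2 * K" for q
  proof -
    have "average (I q) (\<lambda>x. (1 + norm x ^ m)\<^sup>2) Z \<le> average (I q) (\<lambda>x. 2 + 2 * norm x ^ (m * 2)) Z"
      by (rule average_mono) (simp add: young power_mult)
    also have "\<dots> = 2 + 2 * average (I q) (\<lambda>x. norm x ^ (m * 2)) Z"
      using I by (simp add: average_add average_cmult average_const)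
    finally show ?thesis using K[of q] by linarith
  qed
  moreover have "0 \<le> 2 + 2 * K"
    using avg_le[of 0] by (rule order_trans[rotated]) (simp add: average_def sum_nonneg)
  ultimately show ?thesis by (intro exI[of _ "2 + 2 * K"]) simp
qed

lemma weight_integrable:
  "integrable T (\<lambda>x. (1 + norm x ^ m)\<^sup>2)" "integrable T (\<lambda>x. 1 + norm x ^ m)"
proof -
  have cont: "continuous_on UNIV (\<lambda>x::'v. 1 + norm x ^ m)"
    by (intro continuous_intros)
  obtain K where "\<And>q. average (I q) (\<lambda>x. (1 + norm x ^ m)\<^sup>2) Z \<le> K"
    using weight_bound[of m] by auto
  then show int2: "integrable T (\<lambda>x. (1 + norm x ^ m)\<^sup>2)"
    by (intro nonneg_continuous(1)[where K = K] continuous_on_power cont zero_le_power2)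
  show "integrable T (\<lambda>x. 1 + norm x ^ m)"
  proof (rule Bochner_Integration.integrable_bound[OF int2 continuous_T_measurable[OF cont]])
    show "AE x in T. norm (1 + norm x ^ m) \<le> norm ((1 + norm x ^ m)\<^sup>2)"
      by (intro AE_I2) (simp add: self_le_power)
  qed
qed

lemma C_pol_integrable: "integrable T f" if f: "f \<in> C_pol"
proof -
  obtain c m where c: "\<And>x. \<bar>f x\<bar> \<le> c * (1 + norm x ^ m)"
    using f by (auto simp: C_pol_def)
  show ?thesis
  proof (rule Bochner_Integration.integrable_bound)
    show "integrable T (\<lambda>x. c * (1 + norm x ^ m))"
      by (intro integrable_mult_right weight_integrable)
    show "AE x in T. norm (f x) \<le> norm (c * (1 + norm x ^ m))"
      using c by (auto intro: order_trans[OF _ abs_ge_self])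
    show "f \<in> borel_measurable T"
      using f by (intro continuous_T_measurable) (simp add: C_pol_def)
  qed
qed

text \<open>The lower bound for the nonnegative \<open>g\<close> has to be freed from the added
  term. The constant \<open>b\<close> cancels; the quadratic part costs the averages at most e/2 and
  helps on the integral side, being nonnegative.\<close>

lemma C_pol_lower_bound:
  assumes f: "f \<in> C_pol" and "e > 0"
  shows "\<forall>\<^sub>F q in sequentially. (\<integral>x. f x \<partial>T) - e < average (I q) f Z"
proof -
  obtain c m where c: "\<And>x. \<bar>f x\<bar> \<le> c * (1 + norm x ^ m)"
    and cont: "continuous_on UNIV f"
    using f by (auto simp: C_pol_def)
  define w where "w x = 1 + norm x ^ m" for x :: 'v
  obtain K where K: "K \<ge> 0" "\<And>q. average (I q) (\<lambda>x. (w x)\<^sup>2) Z \<le> K"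
    using weight_bound[of m] unfolding w_def by auto
  have w_integrable: "integrable T (\<lambda>x. (w x)\<^sup>2)"
    unfolding w_def by (rule weight_integrable)
  \<comment> \<open>The \<open>+ 1\<close> guards against \<open>K = 0\<close> and still gives
    \<open>d * K \<le> e / 2\<close>.\<close>
  define d where "d = e / (2 * (K + 1))"
  have "d > 0" using K \<open>e > 0\<close> by (simp add: d_def)
  \<comment> \<open>The constant that completes the square in
    \<open>d * t\<^sup>2 - c * t\<close>.\<close>
  define b where "b = c\<^sup>2 / (4 * d)"
  define g where "g x = f x + (d * (w x)\<^sup>2 + b)" for x
  have avg_g: "average (I q) g Z = average (I q) f Z + d * average (I q) (\<lambda>x. (w x)\<^sup>2) Z + b" for q
    unfolding g_def[abs_def] using I by (simp add: average_add average_cmult average_const)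
  have young: "c * w x \<le> d * (w x)\<^sup>2 + b" for x
  proof -
    have "0 \<le> (2 * d * w x - c)\<^sup>2 / (4 * d)" using \<open>d > 0\<close> by simp
    also have "\<dots> = d * (w x)\<^sup>2 + b - c * w x"
      using \<open>d > 0\<close> by (simp add: b_def field_simps power2_eq_square)
    finally show ?thesis by simp
  qed
  have g_nonneg: "0 \<le> g x" and f_le: "f x \<le> d * (w x)\<^sup>2 + b" for x
    using c[of x] young[of x] by (auto simp: g_def w_def)
  have dK: "d * average (I q) (\<lambda>x. (w x)\<^sup>2) Z \<le> e / 2" for q
  proof -
    have "d * average (I q) (\<lambda>x. (w x)\<^sup>2) Z \<le> d * K"
      using K(2) \<open>d > 0\<close> by (intro mult_left_mono) auto
    also have "\<dots> \<le> e / 2"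
      using K(1) \<open>e > 0\<close> by (simp add: d_def field_simps)
    finally show ?thesis .
  qed
  have "average (I q) g Z \<le> e + 2 * b" for q
  proof -
    have "average (I q) f Z \<le> d * average (I q) (\<lambda>x. (w x)\<^sup>2) Z + b"
      using average_mono[of f "\<lambda>x. d * (w x)\<^sup>2 + b" "I q" Z] f_le I
      by (simp add: average_add average_cmult average_const)
    then show ?thesis using dK[of q] by (simp add: avg_g)
  qed
  then have "\<forall>\<^sub>F q in sequentially. (\<integral>x. g x \<partial>T) - e / 2 < average (I q) g Z"
    using g_nonneg \<open>e > 0\<close> cont
    by (intro nonneg_continuous(2)) (auto simp: g_def[abs_def] w_def intro!: continuous_intros)
  moreover have "(\<integral>x. g x \<partial>T) = (\<integral>x. f x \<partial>T) + (d * (\<integral>x. (w x)\<^sup>2 \<partial>T) + b)"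
    unfolding g_def[abs_def] using w_integrable C_pol_integrable[OF f] by (simp add: T.prob_space)
  moreover have "0 \<le> d * (\<integral>x. (w x)\<^sup>2 \<partial>T)"
    using \<open>d > 0\<close> by simp
  ultimately show ?thesis
  proof (elim eventually_mono)
    fix q assume "(\<integral>x. g x \<partial>T) - e / 2 < average (I q) g Z"
    with \<open>(\<integral>x. g x \<partial>T) = _\<close> \<open>0 \<le> d * _\<close> dK[of q]
    show "(\<integral>x. f x \<partial>T) - e < average (I q) f Z"
      unfolding avg_g by linarith
  qed
qed

text \<open>\<open>C_pol\<close> is closed under negation, so the upper bound is the lower bound for
  \<open>- f\<close>.\<close>

theorem C_pol_average_tendsto:
  assumes f: "f \<in> C_pol"
  shows "(\<lambda>q. average (I q) f Z) \<longlonglongrightarrow> (\<integral>x. f x \<partial>T)"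
proof (rule order_tendstoI)
  fix a assume "a < (\<integral>x. f x \<partial>T)"
  then show "\<forall>\<^sub>F q in sequentially. a < average (I q) f Z"
    using C_pol_lower_bound[OF f, of "(\<integral>x. f x \<partial>T) - a"] by simp
next
  fix a assume "(\<integral>x. f x \<partial>T) < a"
  moreover have "(\<lambda>x. - f x) \<in> C_pol"
    using f by (auto simp: C_pol_def intro: continuous_intros)
  moreover have "average (I q) (\<lambda>x. - f x) Z = - average (I q) f Z" for q
    using average_cmult[of "I q" "-1" f Z] by simp
  ultimately show "\<forall>\<^sub>F q in sequentially. average (I q) f Z < a"
    using C_pol_lower_bound[of "\<lambda>x. - f x" "a - (\<integral>x. f x \<partial>T)"] by simp
qed

end

section \<open>Gaussian laws\<close>

text \<open>Completing the square in \<open>z\<close> splits the joint density into the law of the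
  first coordinate and the conditional law of the second, normal with regression mean \<rho> y and
  variance \<sigma>^2 (1 - \<rho>^2).\<close>

lemma normal2_density_factor:
  assumes "\<sigma> > 0" "\<rho> \<in> {-1<..<1}"
  shows "normal2_density 0 0 \<sigma> \<rho> (y, z) =
    normal_density 0 \<sigma> y * normal_density (\<rho> * y) (\<sigma> * sqrt (1 - \<rho>\<^sup>2)) z"
proof -
  define d where "d = 1 - \<rho>\<^sup>2"
  have d: "d > 0"
    using assms(2) abs_square_less_1[of \<rho>] by (auto simp: d_def)
  have exponent: "- (y\<^sup>2 - 2 * \<rho> * y * z + z\<^sup>2) / (2 * \<sigma>\<^sup>2 * d)
      = - y\<^sup>2 / (2 * \<sigma>\<^sup>2) - (z - \<rho> * y)\<^sup>2 / (2 * (\<sigma>\<^sup>2 * d))"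
    using d assms(1) by (simp add: field_simps) (simp add: d_def power2_eq_square algebra_simps)
  have norming: "sqrt (2 * pi * \<sigma>\<^sup>2) * sqrt (2 * pi * (\<sigma>\<^sup>2 * d)) = 2 * pi * \<sigma>\<^sup>2 * sqrt d"
  proof -
    have "sqrt x * sqrt (x * d) = x * sqrt d" if "x \<ge> 0" for x
      using that by (simp add: real_sqrt_mult flip: mult.assoc)
    from this[of "2 * pi * \<sigma>\<^sup>2"] show ?thesis by (simp add: mult.assoc)
  qed
  have "normal_density 0 \<sigma> y * normal_density (\<rho> * y) (\<sigma> * sqrt d) z
      = 1 / (sqrt (2 * pi * \<sigma>\<^sup>2) * sqrt (2 * pi * (\<sigma>\<^sup>2 * d))) *
        (exp (- y\<^sup>2 / (2 * \<sigma>\<^sup>2)) * exp (- (z - \<rho> * y)\<^sup>2 / (2 * (\<sigma>\<^sup>2 * d))))"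
    using d by (simp add: normal_density_def power_mult_distrib)
  also have "\<dots> = normal2_density 0 0 \<sigma> \<rho> (y, z)"
    unfolding norming exp_add[symmetric] normal2_density_def
    using exponent by (simp add: d_def)
  finally show ?thesis by (simp add: d_def)
qed

lemma normal2_density_swap: "normal2_density 0 0 \<sigma> \<rho> (y, z) = normal2_density 0 0 \<sigma> \<rho> (z, y)"
  by (simp add: normal2_density_def algebra_simps)

lemma fst_snd_borel_measurable [measurable]:
  "fst \<in> borel_measurable (borel :: ('a::second_countable_topology \<times> 'b::second_countable_topology) measure)"
  "snd \<in> borel_measurable (borel :: ('a \<times> 'b) measure)"
  by (auto intro!: borel_measurable_continuous_onI continuous_intros)

lemma normal2_density_measurable [measurable]: "normal2_density a b \<sigma> \<rho> \<in> borel_measurable borel"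
  unfolding normal2_density_def case_prod_beta borel_prod[symmetric] by measurable

lemma sets_gauss2 [simp, measurable_cong]: "sets (gauss2 a b \<sigma> \<rho>) = sets borel"
  by (simp add: gauss2_def)

lemma space_gauss2 [simp]: "space (gauss2 a b \<sigma> \<rho>) = UNIV"
  by (simp add: gauss2_def)

lemma sets_gauss [simp, measurable_cong]: "sets (gauss a \<sigma>) = sets borel"
  by (simp add: gauss_def)

lemma nn_integral_normal_density:
  assumes "s > 0"
  shows "(\<integral>\<^sup>+z. ennreal (normal_density m s z) \<partial>lborel) = 1"
proof -
  interpret prob_space "density lborel (normal_density m s)"
    by (rule prob_space_normal_density[OF assms])
  show ?thesis
    using emeasure_space_1 by (simp add: emeasure_density)
qed

section \<open>Marginals and translates of the bivariate law\<close>

lemma nn_integral_normal2_density_snd: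
  assumes "\<sigma> > 0" "\<rho> \<in> {-1<..<1}"
  shows "(\<integral>\<^sup>+z. ennreal (normal2_density 0 0 \<sigma> \<rho> (y, z)) \<partial>lborel) = ennreal (normal_density 0 \<sigma> y)"
proof -
  have "0 < \<sigma> * sqrt (1 - \<rho>\<^sup>2)"
    using assms abs_square_less_1[of \<rho>] by auto
  from nn_integral_normal_density[OF this] show ?thesis
    by (simp add: normal2_density_factor[OF assms] ennreal_mult normal_density_nonneg nn_integral_cmult)
qed

lemma emeasure_distr_gauss2:
  assumes [measurable]: "g \<in> borel_measurable borel" "A \<in> sets borel"
  shows "emeasure (distr (gauss2 a b \<sigma> \<rho>) borel g) A
    = (\<integral>\<^sup>+p. ennreal (normal2_density a b \<sigma> \<rho> p) * indicator A (g p) \<partial>lborel)"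
proof -
  have "emeasure (distr (gauss2 a b \<sigma> \<rho>) borel g) A
      = (\<integral>\<^sup>+x. indicator A x \<partial>distr (gauss2 a b \<sigma> \<rho>) borel g)"
    by simp
  also have "\<dots> = (\<integral>\<^sup>+p. indicator A (g p) \<partial>gauss2 a b \<sigma> \<rho>)"
    by (rule nn_integral_distr) measurable
  also have "\<dots> = (\<integral>\<^sup>+p. ennreal (normal2_density a b \<sigma> \<rho> p) * indicator A (g p) \<partial>lborel)"
    unfolding gauss2_def by (rule nn_integral_density) measurable
  finally show ?thesis .
qed

lemma distr_gauss2_fst:
  assumes "\<sigma> > 0" "\<rho> \<in> {-1<..<1}"
  shows "distr (gauss2 0 0 \<sigma> \<rho>) borel fst = gauss 0 \<sigma>"
proof (rule measure_eqI)
  fix A assume "A \<in> sets (distr (gauss2 0 0 \<sigma> \<rho>) borel fst)"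
  then have A [measurable]: "A \<in> sets borel" by simp
  have "emeasure (distr (gauss2 0 0 \<sigma> \<rho>) borel fst) A =
      (\<integral>\<^sup>+p. ennreal (normal2_density 0 0 \<sigma> \<rho> p) * indicator A (fst p) \<partial>(lborel \<Otimes>\<^sub>M lborel))"
    unfolding lborel_prod by (rule emeasure_distr_gauss2) simp_all
  also have "\<dots> = (\<integral>\<^sup>+y. \<integral>\<^sup>+z. ennreal (normal2_density 0 0 \<sigma> \<rho> (y, z)) * indicator A y \<partial>lborel \<partial>lborel)"
    by (subst lborel.nn_integral_fst[symmetric]) (simp_all add: lborel_prod)
  also have "\<dots> = (\<integral>\<^sup>+y. ennreal (normal_density 0 \<sigma> y) * indicator A y \<partial>lborel)"
    by (simp add: nn_integral_multc nn_integral_normal2_density_snd[OF assms])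
  also have "\<dots> = emeasure (gauss 0 \<sigma>) A"
    by (simp add: gauss_def emeasure_density)
  finally show "emeasure (distr (gauss2 0 0 \<sigma> \<rho>) borel fst) A = emeasure (gauss 0 \<sigma>) A" .
qed simp

lemma distr_gauss2_snd:
  assumes "\<sigma> > 0" "\<rho> \<in> {-1<..<1}"
  shows "distr (gauss2 0 0 \<sigma> \<rho>) borel snd = gauss 0 \<sigma>"
proof (rule measure_eqI)
  fix A assume "A \<in> sets (distr (gauss2 0 0 \<sigma> \<rho>) borel snd)"
  then have A [measurable]: "A \<in> sets borel" by simp
  have "emeasure (distr (gauss2 0 0 \<sigma> \<rho>) borel snd) A =
      (\<integral>\<^sup>+p. ennreal (normal2_density 0 0 \<sigma> \<rho> p) * indicator A (snd p) \<partial>(lborel \<Otimes>\<^sub>M lborel))"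
    unfolding lborel_prod by (rule emeasure_distr_gauss2) simp_all
  also have "\<dots> = (\<integral>\<^sup>+z. \<integral>\<^sup>+y. ennreal (normal2_density 0 0 \<sigma> \<rho> (y, z)) * indicator A z \<partial>lborel \<partial>lborel)"
    by (subst lborel_pair.nn_integral_snd[symmetric]) (simp_all add: lborel_prod)
  also have "\<dots> = (\<integral>\<^sup>+z. ennreal (normal_density 0 \<sigma> z) * indicator A z \<partial>lborel)"
    \<comment> \<open>Symmetry in the two coordinates turns the inner integral into the one known
      for the first marginal.\<close>
    by (subst normal2_density_swap) (simp add: nn_integral_multc nn_integral_normal2_density_snd[OF assms])
  also have "\<dots> = emeasure (gauss 0 \<sigma>) A"
    by (simp add: gauss_def emeasure_density)
  finally show "emeasure (distr (gauss2 0 0 \<sigma> \<rho>) borel snd) A = emeasure (gauss 0 \<sigma>) A" .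
qed simp

lemma prob_space_gauss: "\<sigma> > 0 \<Longrightarrow> prob_space (gauss m \<sigma>)"
  unfolding gauss_def by (rule prob_space_normal_density)

lemma distr_gauss_shift:
  assumes "\<sigma> > 0"
  shows "distr (gauss 0 \<sigma>) borel (\<lambda>y. c + y) = gauss c \<sigma>"
proof -
  interpret prob_space "gauss 0 \<sigma>" by (rule prob_space_gauss[OF assms])
  have "distributed (gauss 0 \<sigma>) lborel (\<lambda>y. y) (normal_density 0 \<sigma>)"
    by (auto simp: distributed_def gauss_def normal_density_nonneg intro!: measure_eqI simp: emeasure_distr)
  from normal_density_affine[OF this assms, of 1 c] show ?thesis
    by (simp add: distributed_def gauss_def cong: distr_cong)
qed

lemma distr_gauss2_shift:
  "distr (gauss2 0 0 \<sigma> \<rho>) borel (\<lambda>p. (a, b) + p) = gauss2 a b \<sigma> \<rho>"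
proof (rule measure_eqI)
  fix A assume "A \<in> sets (distr (gauss2 0 0 \<sigma> \<rho>) borel (\<lambda>p. (a, b) + p))"
  then have A [measurable]: "A \<in> sets borel" by simp
  have shift: "normal2_density a b \<sigma> \<rho> ((a, b) + p) = normal2_density 0 0 \<sigma> \<rho> p" for p
    by (cases p) (simp add: normal2_density_def)
  have "emeasure (gauss2 a b \<sigma> \<rho>) A
      = (\<integral>\<^sup>+p. ennreal (normal2_density a b \<sigma> \<rho> p) * indicator A p \<partial>distr lborel borel (\<lambda>p. (a, b) + p))"
    by (simp add: gauss2_def emeasure_density lborel_distr_plus)
  also have "\<dots> = (\<integral>\<^sup>+p. ennreal (normal2_density 0 0 \<sigma> \<rho> p) * indicator A ((a, b) + p) \<partial>lborel)"
    by (subst nn_integral_distr) (simp_all add: shift)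
  also have "\<dots> = emeasure (distr (gauss2 0 0 \<sigma> \<rho>) borel (\<lambda>p. (a, b) + p)) A"
    by (subst emeasure_distr_gauss2) simp_all
  finally show "emeasure (distr (gauss2 0 0 \<sigma> \<rho>) borel (\<lambda>p. (a, b) + p)) A = emeasure (gauss2 a b \<sigma> \<rho>) A" ..
qed simp

section \<open>Gaussian moments\<close>

lemma integrable_gauss_power:
  assumes "\<sigma> > 0"
  shows "integrable (gauss 0 \<sigma>) (\<lambda>y. \<bar>y\<bar> ^ k)"
  using integrable_normal_moment_abs[OF assms, of 0 k]
  by (simp add: gauss_def integrable_density normal_density_nonneg)

lemma power_add_le:
  fixes u v :: real
  assumes "0 \<le> u" "0 \<le> v"
  shows "(u + v) ^ k \<le> 2 ^ k * (u ^ k + v ^ k)"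
proof -
  have "(u + v) ^ k \<le> (2 * max u v) ^ k"
    using assms by (intro power_mono) auto
  also have "\<dots> \<le> 2 ^ k * (u ^ k + v ^ k)"
    using assms by (auto simp: power_mult_distrib max_def)
  finally show ?thesis .
qed

text \<open>Splitting the power of the sum twice leaves absolute moments of each coordinate
  separately, so the two marginals suffice. The constant \<open>b\<close> makes room for the
  intercepts of the recursion.\<close>

lemma integrable_gauss2_power:
  assumes "\<sigma> > 0" "\<rho> \<in> {-1<..<1}" "b \<ge> 0"
  shows "integrable (gauss2 0 0 \<sigma> \<rho>) (\<lambda>p. (b + (\<bar>fst p\<bar> + \<bar>snd p\<bar>)) ^ k)"
proof (rule Bochner_Integration.integrable_bound)
  \<comment> \<open>The total mass is read off from the first marginal.\<close>
  interpret prob_space "gauss2 0 0 \<sigma> \<rho>"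
  proof -
    interpret G: prob_space "gauss 0 \<sigma>" by (rule prob_space_gauss[OF assms(1)])
    have "emeasure (distr (gauss2 0 0 \<sigma> \<rho>) borel fst) UNIV = 1"
      using G.emeasure_space_1 by (simp add: distr_gauss2_fst[OF assms(1,2)] gauss_def)
    then show "prob_space (gauss2 0 0 \<sigma> \<rho>)"
      by (intro prob_spaceI) (simp add: emeasure_distr del: borel_prod)
  qed
  have "integrable (gauss2 0 0 \<sigma> \<rho>) (\<lambda>p. \<bar>fst p\<bar> ^ k)"
    using integrable_gauss_power[OF assms(1), of k]
    unfolding distr_gauss2_fst[OF assms(1,2), symmetric] by (simp add: integrable_distr_eq)
  moreover have "integrable (gauss2 0 0 \<sigma> \<rho>) (\<lambda>p. \<bar>snd p\<bar> ^ k)"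
    using integrable_gauss_power[OF assms(1), of k]
    unfolding distr_gauss2_snd[OF assms(1,2), symmetric] by (simp add: integrable_distr_eq)
  ultimately show "integrable (gauss2 0 0 \<sigma> \<rho>)
      (\<lambda>p. 2 ^ k * (b ^ k + 2 ^ k * (\<bar>fst p\<bar> ^ k + \<bar>snd p\<bar> ^ k)))"
    by simp
  show "AE p in gauss2 0 0 \<sigma> \<rho>. norm ((b + (\<bar>fst p\<bar> + \<bar>snd p\<bar>)) ^ k)
      \<le> norm (2 ^ k * (b ^ k + 2 ^ k * (\<bar>fst p\<bar> ^ k + \<bar>snd p\<bar> ^ k)))"
  proof (intro AE_I2)
    fix p :: "real \<times> real"
    have "(b + (\<bar>fst p\<bar> + \<bar>snd p\<bar>)) ^ k \<le> 2 ^ k * (b ^ k + (\<bar>fst p\<bar> + \<bar>snd p\<bar>) ^ k)"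
      using assms(3) by (intro power_add_le) auto
    also have "\<dots> \<le> 2 ^ k * (b ^ k + 2 ^ k * (\<bar>fst p\<bar> ^ k + \<bar>snd p\<bar> ^ k))"
      by (intro mult_left_mono add_left_mono power_add_le) auto
    finally show "norm ((b + (\<bar>fst p\<bar> + \<bar>snd p\<bar>)) ^ k)
        \<le> norm (2 ^ k * (b ^ k + 2 ^ k * (\<bar>fst p\<bar> ^ k + \<bar>snd p\<bar> ^ k)))"
      using assms(3) by (auto intro: order_trans[OF _ abs_ge_self])
  qed
qed simp

section \<open>Orthogonality within a generation\<close>

context bar_model
begin

section \<open>Ancestor and noise as one independent family\<close>

definition noise :: "nat \<Rightarrow> 'a \<Rightarrow> real \<times> real" where
  "noise n \<omega> = (\<epsilon> (2 * n) \<omega>, \<epsilon> (2 * n + 1) \<omega>)"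

abbreviation \<gamma> :: "(real \<times> real) measure" where
  "\<gamma> \<equiv> gauss2 0 0 \<sigma> \<rho>"

lemma noise_measurable [measurable]: "n \<ge> 1 \<Longrightarrow> noise n \<in> borel_measurable M"
  using noise_indep unfolding indep_vars_def noise_def[abs_def] by auto

lemma distr_noise: "n \<ge> 1 \<Longrightarrow> distr M borel (noise n) = \<gamma>"
  using noise_distr unfolding noise_def[abs_def] by simp

lemma prob_space_\<gamma>: "prob_space \<gamma>"
  using distr_noise[of 1] prob_space_distr[OF noise_measurable[of 1]] by simp

lemma X_measurable [measurable]: "n \<ge> 1 \<Longrightarrow> X n \<in> borel_measurable M"
proof (induction n rule: less_induct)
  case (less n)
  show ?case
  proof (cases "n = 1")
    case True
    then show ?thesis using X1_rv by simp
  next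
    case False
    define m where "m = n div 2"
    have m: "m \<ge> 1" "m < n" using less.prems False by (auto simp: m_def)
    note [measurable] = less.IH[OF m(2,1)] noise_measurable[OF m(1)]
    consider "n = 2 * m" | "n = 2 * m + 1" unfolding m_def by linarith
    then show ?thesis
    proof cases
      case 1
      have "(\<lambda>\<omega>. \<alpha>0 * X m \<omega> + \<beta>0 + fst (noise m \<omega>)) \<in> borel_measurable M" by measurable
      then show ?thesis
        by (rule measurable_cong[THEN iffD1, rotated]) (simp add: 1 X_even[OF m(1)] noise_def)
    next
      case 2
      have "(\<lambda>\<omega>. \<alpha>1 * X m \<omega> + \<beta>1 + snd (noise m \<omega>)) \<in> borel_measurable M" by measurable
      then show ?thesis
        by (rule measurable_cong[THEN iffD1, rotated]) (simp add: 2 X_odd[OF m(1), simplified] noise_def)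
    qed
  qed
qed

text \<open>The ancestor is stored at index 0, so that ancestor and noise form one independent family.\<close>

definition source :: "nat \<Rightarrow> 'a \<Rightarrow> real \<times> real" where
  "source n = (if n = 0 then (\<lambda>\<omega>. (X 1 \<omega>, 0)) else noise n)"

lemma source_measurable [measurable]: "source n \<in> borel_measurable M"
proof (cases "n = 0")
  case True
  have "(\<lambda>\<omega>. (X 1 \<omega>, 0::real)) \<in> borel_measurable M"
    using X1_rv by (intro borel_measurable_Pair) auto
  then show ?thesis using True by (simp add: source_def)
qed (simp add: source_def)

lemma source_noise: "n \<ge> 1 \<Longrightarrow> source n = noise n"
  by (simp add: source_def)

text \<open>For a finite set of indices, those other than 0 are handled by the independence of the
  noise. Independence of the ancestor from the whole noise sequence is called upon only when 0
  occurs together with other indices.\<close>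

lemma indep_source: "indep_vars (\<lambda>_. borel) source UNIV"
  unfolding indep_vars_def2
proof (intro conjI ballI)
  show "indep_sets (\<lambda>n. {source n -` A \<inter> space M |A. A \<in> sets borel}) UNIV"
  proof (rule indep_setsI)
    fix A J assume J: "J \<noteq> {}" "J \<subseteq> UNIV" "finite (J :: nat set)"
      and A: "\<forall>j\<in>J. A j \<in> {source j -` B \<inter> space M |B. B \<in> sets borel}"
    have noise_sets: "indep_sets (\<lambda>n. {noise n -` B \<inter> space M |B. B \<in> sets borel}) {1..}"
      using noise_indep by (simp add: indep_vars_def2 noise_def[abs_def])
    define J' where "J' = J - {0}"
    have J': "J' \<subseteq> {1..}" "finite J'" using J by (auto simp: J'_def)
    have A': "\<forall>j\<in>J'. A j \<in> {noise j -` B \<inter> space M |B. B \<in> sets borel}"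
      using A by (force simp: J'_def source_def)
    have prod': "prob (\<Inter>j\<in>J'. A j) = (\<Prod>j\<in>J'. prob (A j))" if "J' \<noteq> {}"
      using indep_setsD[OF noise_sets J'(1) that J'(2) A'] .
    show "prob (\<Inter>j\<in>J. A j) = (\<Prod>j\<in>J. prob (A j))"
    proof (cases "0 \<in> J \<and> J' \<noteq> {}")
      case True
      then have ins: "J = insert 0 J'" by (auto simp: J'_def)
      obtain B0 where B0: "B0 \<in> sets borel" "A 0 = source 0 -` B0 \<inter> space M"
        using bspec[OF A, of 0] True by blast
      \<comment> \<open>The second coordinate of \<open>source 0\<close> is constant, so its events
        are events of \<open>X 1\<close> alone.\<close>
      have "(\<lambda>x::real. (x, 0::real)) -` B0 \<in> sets borel"
        using B0(1) measurable_sets[of "\<lambda>x::real. (x, 0::real)" borel borel B0] by auto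
      then have "A 0 \<in> sets (vimage_algebra (space M) (X 1) borel)"
        using in_vimage_algebra[of "(\<lambda>x. (x, 0)) -` B0" borel "X 1" "space M"]
        by (simp add: B0 source_def vimage_def)
      moreover have "(\<Inter>j\<in>J'. A j) \<in> sets (vimage_algebra (space M)
            (\<lambda>\<omega>. \<lambda>n\<in>{1..}. (\<epsilon> (2 * n) \<omega>, \<epsilon> (2 * n + 1) \<omega>)) (Pi\<^sub>M {1..} (\<lambda>_. borel)))"
        (is "_ \<in> sets ?V")
      proof (intro sets.finite_INT J' conjunct2[OF True])
        fix j assume j: "j \<in> J'"
        then obtain B where B: "B \<in> sets borel" "A j = noise j -` B \<inter> space M"
          using A' by blast
        have j1: "j \<in> {1..}" using j J' by auto
        have "(\<lambda>x. x j) -` B \<inter> space (Pi\<^sub>M {1..} (\<lambda>_. borel)) \<in> sets (Pi\<^sub>M {1..} (\<lambda>_. borel :: (real \<times> real) measure))"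
          using B(1) j1 by (intro measurable_sets[OF measurable_component_singleton]) auto
        from in_vimage_algebra[OF this] show "A j \<in> sets ?V"
        proof (rule back_subst[where P = "\<lambda>S. S \<in> sets ?V"])
          show "(\<lambda>\<omega>. \<lambda>n\<in>{1..}. (\<epsilon> (2 * n) \<omega>, \<epsilon> (2 * n + 1) \<omega>)) -`
            ((\<lambda>x. x j) -` B \<inter> space (Pi\<^sub>M {1..} (\<lambda>_. borel))) \<inter> space M = A j"
            using j1 by (auto simp: B noise_def space_PiM)
        qed
      qed
      ultimately have "prob (A 0 \<inter> (\<Inter>j\<in>J'. A j)) = prob (A 0) * prob (\<Inter>j\<in>J'. A j)"
        by (rule indep_setD[OF noise_indep_X1])
      moreover have "0 \<notin> J'" by (simp add: J'_def)
      ultimately show ?thesis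
        using prod' True J' by (simp add: ins)
    next
      case False
      then have "J = {0} \<or> J = J'" using J by (auto simp: J'_def)
      then show ?thesis
      proof
        assume "J = J'"
        then show ?thesis using prod' J(1) by metis
      qed simp
    qed
  qed auto
qed simp

text \<open>A value depends on the ancestor and on the noise of strict ancestors, all with index at
  most \<open>n div 2\<close>. Asking for the whole initial segment makes the hypothesis pass to the
  mother; allowing a larger \<open>A\<close> lets two vertices share one index set.\<close>

lemma X_function_of_source:
  assumes "n \<ge> 1" "{..n div 2} \<subseteq> A"
  shows "\<exists>g\<in>borel_measurable (Pi\<^sub>M A (\<lambda>_. borel :: (real \<times> real) measure)).
    \<forall>\<omega>\<in>space M. X n \<omega> = g (restrict (\<lambda>k. source k \<omega>) A)"
  using assms
proof (induction n rule: less_induct)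
  case (less n)
  define m where "m = n div 2"
  have comp: "(\<lambda>x. x m) \<in> measurable (Pi\<^sub>M A (\<lambda>_. borel)) (borel :: (real \<times> real) measure)"
    and mA: "m \<in> A"
    using less.prems by (auto simp: m_def intro!: measurable_component_singleton)
  note [measurable] = comp
  show ?case
  proof (cases "n = 1")
    case True
    \<comment> \<open>\<open>1 div 2 = 0\<close> is the index under which the ancestor is
      stored.\<close>
    then have "m = 0" by (simp add: m_def)
    then show ?thesis
      using mA True by (intro bexI[of _ "\<lambda>x. fst (x m)"]) (auto simp: source_def)
  next
    case False
    have m: "m \<ge> 1" "m < n" using less.prems False by (auto simp: m_def)
    have "{..m div 2} \<subseteq> A" using less.prems(2) by (auto simp: m_def)
    then obtain g where g: "g \<in> borel_measurable (Pi\<^sub>M A (\<lambda>_. borel))"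
        "\<And>\<omega>. \<omega> \<in> space M \<Longrightarrow> X m \<omega> = g (restrict (\<lambda>k. source k \<omega>) A)"
      using less.IH[OF m(2,1)] by blast
    note [measurable] = g(1)
    consider "n = 2 * m" | "n = 2 * m + 1" unfolding m_def by linarith
    then show ?thesis
    proof cases
      case 1
      then show ?thesis
        using mA m by (intro bexI[of _ "\<lambda>x. \<alpha>0 * g x + \<beta>0 + fst (x m)"])
          (auto simp: source_noise noise_def X_even[OF m(1)] g(2) restrict_def)
    next
      case 2
      then show ?thesis
        using mA m by (intro bexI[of _ "\<lambda>x. \<alpha>1 * g x + \<beta>1 + snd (x m)"])
          (auto simp: source_noise noise_def X_odd[OF m(1), simplified] g(2) restrict_def)
    qed
  qed
qed

text \<open>Because \<open>indep_var\<close> relates variables of one type, the noise is first embedded by \<open>E\<close>.\<close>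

lemma distr_past_noise:
  assumes i: "i \<in> generation q" and j: "j \<in> generation q" and "i \<noteq> j"
  shows "distr M (borel \<Otimes>\<^sub>M borel) (\<lambda>\<omega>. ((X i \<omega>, X j \<omega>, noise j \<omega>), noise i \<omega>))
    = distr M borel (\<lambda>\<omega>. (X i \<omega>, X j \<omega>, noise j \<omega>)) \<Otimes>\<^sub>M \<gamma>"
proof -
  define A where "A = UNIV - {i}"
  define E where "E = (\<lambda>p::real \<times> real. (0::real, 0::real, p))"
  have E [measurable]: "E \<in> borel_measurable borel"
    unfolding E_def by (intro borel_measurable_continuous_onI continuous_intros)
  define W where "W = (\<lambda>\<omega>. (X i \<omega>, X j \<omega>, noise j \<omega>))"
  have pos: "i \<ge> 1" "j \<ge> 1" using i j by (auto dest: generation_ge_1)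
  have W_measurable [measurable]: "W \<in> borel_measurable M"
    unfolding W_def using pos by (intro borel_measurable_Pair) auto
  note [measurable] = noise_measurable[OF pos(1)]
  \<comment> \<open>Halving a member of generation \<open>q\<close> gives an index below 2^q, hence
    below \<open>i\<close>. So no value in this generation involves \<open>noise i\<close>, and
    \<open>A\<close> may consist of all indices except \<open>i\<close>.\<close>
  have "k div 2 < i" if "k \<in> generation q" for k
    using i that by (auto simp: generation_iff)
  then have "{..k div 2} \<subseteq> A" if "k \<in> generation q" for k
    using that by (force simp: A_def)
  then obtain gi gj where
    g [measurable]: "gi \<in> borel_measurable (Pi\<^sub>M A (\<lambda>_. borel :: (real \<times> real) measure))"
        "gj \<in> borel_measurable (Pi\<^sub>M A (\<lambda>_. borel :: (real \<times> real) measure))"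
    and eq: "\<And>\<omega>. \<omega> \<in> space M \<Longrightarrow> X i \<omega> = gi (restrict (\<lambda>k. source k \<omega>) A)"
        "\<And>\<omega>. \<omega> \<in> space M \<Longrightarrow> X j \<omega> = gj (restrict (\<lambda>k. source k \<omega>) A)"
    using X_function_of_source[OF pos(1)] X_function_of_source[OF pos(2)] i j by metis
  have "j \<in> A" using \<open>i \<noteq> j\<close> by (simp add: A_def)
  then have [measurable]: "(\<lambda>x. x j) \<in> measurable (Pi\<^sub>M A (\<lambda>_. borel)) (borel :: (real \<times> real) measure)"
    by (intro measurable_component_singleton)
  have past: "(\<lambda>x. (gi x, gj x, x j)) \<in> measurable (Pi\<^sub>M A (\<lambda>_. borel)) borel"
    by (intro borel_measurable_Pair) measurable
  have [measurable]: "(\<lambda>x. x i) \<in> measurable (Pi\<^sub>M {i} (\<lambda>_. borel)) (borel :: (real \<times> real) measure)"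
    by (intro measurable_component_singleton) simp
  have present: "(\<lambda>x. E (x i)) \<in> measurable (Pi\<^sub>M {i} (\<lambda>_. borel)) borel"
    by measurable
  have "indep_var (Pi\<^sub>M A (\<lambda>_. borel)) (\<lambda>\<omega>. restrict (\<lambda>k. source k \<omega>) A)
      (Pi\<^sub>M {i} (\<lambda>_. borel)) (\<lambda>\<omega>. restrict (\<lambda>k. source k \<omega>) {i})"
    by (rule indep_var_restrict[OF indep_source]) (auto simp: A_def)
  note indep_var_compose[OF this past present, unfolded indep_var_distribution_eq]
  moreover have "distr M borel ((\<lambda>x. (gi x, gj x, x j)) \<circ> (\<lambda>\<omega>. restrict (\<lambda>k. source k \<omega>) A)) = distr M borel W"
    using \<open>j \<in> A\<close> pos by (intro distr_cong) (auto simp: W_def eq source_def)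
  moreover have "distr M borel ((\<lambda>x. E (x i)) \<circ> (\<lambda>\<omega>. restrict (\<lambda>k. source k \<omega>) {i})) = distr M borel (\<lambda>\<omega>. E (noise i \<omega>))"
    using pos by (intro distr_cong) (auto simp: source_def)
  moreover have "distr M (borel \<Otimes>\<^sub>M borel) (\<lambda>\<omega>. (((\<lambda>x. (gi x, gj x, x j)) \<circ> (\<lambda>\<omega>. restrict (\<lambda>k. source k \<omega>) A)) \<omega>,
        ((\<lambda>x. E (x i)) \<circ> (\<lambda>\<omega>. restrict (\<lambda>k. source k \<omega>) {i})) \<omega>))
      = distr M (borel \<Otimes>\<^sub>M borel) (\<lambda>\<omega>. (W \<omega>, E (noise i \<omega>)))"
    using \<open>j \<in> A\<close> pos by (intro distr_cong) (auto simp: W_def eq source_def)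
  ultimately have prod: "distr M borel W \<Otimes>\<^sub>M distr M borel (\<lambda>\<omega>. E (noise i \<omega>))
      = distr M (borel \<Otimes>\<^sub>M borel) (\<lambda>\<omega>. (W \<omega>, E (noise i \<omega>)))"
    by simp
  \<comment> \<open>The projection that undoes the embedding \<open>E\<close>; pushing the product
    law forward along it recovers the pair with the plain noise.\<close>
  have [measurable]: "(\<lambda>e::real \<times> real \<times> real \<times> real. snd (snd e)) \<in> borel_measurable borel"
    by (intro borel_measurable_continuous_onI continuous_intros)
  have EE: "snd (snd (E p)) = p" for p by (simp add: E_def)
  have gamma: "distr (distr M borel (\<lambda>\<omega>. E (noise i \<omega>))) borel (\<lambda>e. snd (snd e)) = \<gamma>"
    using distr_noise[OF pos(1)] by (subst distr_distr) (simp_all add: comp_def EE)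
  interpret g: prob_space \<gamma> by (rule prob_space_\<gamma>)
  have "distr M borel W \<Otimes>\<^sub>M \<gamma> = distr (distr M borel W) borel (\<lambda>w. w) \<Otimes>\<^sub>M
      distr (distr M borel (\<lambda>\<omega>. E (noise i \<omega>))) borel (\<lambda>e. snd (snd e))"
    unfolding gamma by (simp add: distr_id2)
  also have "\<dots> = distr (distr M borel W \<Otimes>\<^sub>M distr M borel (\<lambda>\<omega>. E (noise i \<omega>)))
      (borel \<Otimes>\<^sub>M borel) (\<lambda>(w, e). (w, snd (snd e)))"
    by (rule pair_measure_distr) (auto simp: gamma intro: g.sigma_finite_measure_axioms)
  also have "\<dots> = distr M (borel \<Otimes>\<^sub>M borel) (\<lambda>\<omega>. (W \<omega>, noise i \<omega>))"
    unfolding prod by (subst distr_distr) (simp_all add: comp_def EE del: borel_prod)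
  finally show ?thesis by (simp add: W_def)
qed

text \<open>Fubini with \<open>noise i\<close> integrated first: once the triple \<open>W\<close> is
  fixed, the factor at \<open>j\<close> is a constant and the factor at \<open>i\<close> has mean
  0.\<close>

lemma expectation_product_zero:
  fixes F :: "real \<times> real \<times> real \<Rightarrow> real"
  assumes F [measurable]: "F \<in> borel_measurable borel"
    and centred: "\<And>x. (\<integral>p. F (x, p) \<partial>\<gamma>) = 0"
    and ij: "i \<in> generation q" "j \<in> generation q" "i \<noteq> j"
    and integrable: "integrable M (\<lambda>\<omega>. F (X i \<omega>, noise i \<omega>) * F (X j \<omega>, noise j \<omega>))"
  shows "expectation (\<lambda>\<omega>. F (X i \<omega>, noise i \<omega>) * F (X j \<omega>, noise j \<omega>)) = 0"
proof -
  define W where "W = (\<lambda>\<omega>. (X i \<omega>, X j \<omega>, noise j \<omega>))"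
  define G where "G = (\<lambda>(w::real \<times> real \<times> real \<times> real) (p::real \<times> real). F (fst w, p) * F (snd w))"
  have pos: "i \<ge> 1" "j \<ge> 1" using ij by (auto dest: generation_ge_1)
  have W [measurable]: "W \<in> borel_measurable M"
    unfolding W_def using pos by (intro borel_measurable_Pair) auto
  note [measurable] = noise_measurable[OF pos(1)]
  have joint: "distr M (borel \<Otimes>\<^sub>M borel) (\<lambda>\<omega>. (W \<omega>, noise i \<omega>)) = distr M borel W \<Otimes>\<^sub>M \<gamma>"
    unfolding W_def by (rule distr_past_noise[OF ij])
  have G [measurable]: "case_prod G \<in> borel_measurable (borel \<Otimes>\<^sub>M borel)"
  proof -
    have "(\<lambda>u :: (real \<times> real \<times> real \<times> real) \<times> (real \<times> real). F (fst (fst u), snd u)) \<in> borel_measurable (borel \<Otimes>\<^sub>M borel)"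
    proof -
      have "(\<lambda>u :: (real \<times> real \<times> real \<times> real) \<times> (real \<times> real). (fst (fst u), snd u)) \<in> borel_measurable (borel \<Otimes>\<^sub>M borel)"
        by (intro borel_measurable_Pair measurable_compose[OF measurable_fst fst_snd_borel_measurable(1)]
            measurable_snd)
      from measurable_compose[OF this F] show ?thesis .
    qed
    moreover have "(\<lambda>u :: (real \<times> real \<times> real \<times> real) \<times> (real \<times> real). F (snd (fst u))) \<in> borel_measurable (borel \<Otimes>\<^sub>M borel)"
      using measurable_compose[OF measurable_compose[OF measurable_fst fst_snd_borel_measurable(2)] F] .
    ultimately show ?thesis
      unfolding G_def case_prod_beta by (rule borel_measurable_times)
  qed
  interpret g: prob_space \<gamma> by (rule prob_space_\<gamma>)
  interpret w: prob_space "distr M borel W" by (rule prob_space_distr) (rule W)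
  interpret pair_sigma_finite "distr M borel W" \<gamma> ..
  have eq: "F (X i \<omega>, noise i \<omega>) * F (X j \<omega>, noise j \<omega>) = case_prod G (W \<omega>, noise i \<omega>)" for \<omega>
    by (simp add: G_def W_def)
  have "integrable (distr M borel W \<Otimes>\<^sub>M \<gamma>) (case_prod G)"
    unfolding joint[symmetric] using integrable by (subst integrable_distr_eq) (simp_all add: eq del: borel_prod)
  then have "(\<integral>w. \<integral>p. G w p \<partial>\<gamma> \<partial>distr M borel W) = integral\<^sup>L (distr M borel W \<Otimes>\<^sub>M \<gamma>) (case_prod G)"
    by (rule integral_fst)
  also have "\<dots> = expectation (\<lambda>\<omega>. case_prod G (W \<omega>, noise i \<omega>))"
    unfolding joint[symmetric] by (subst integral_distr) (simp_all del: borel_prod)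
  also have "(\<integral>w. \<integral>p. G w p \<partial>\<gamma> \<partial>distr M borel W) = 0"
    by (simp add: G_def centred)
  finally show ?thesis by (simp add: eq)
qed

text \<open>Because \<open>B\<close> is a function of the noise, all vertices share the second
  moment bound \<open>b\<close>, whatever the law of \<open>X i\<close>.\<close>

lemma fluctuation_tendsto_0:
  fixes F :: "real \<times> real \<times> real \<Rightarrow> real"
  assumes F [measurable]: "F \<in> borel_measurable borel"
    and centred: "\<And>x. (\<integral>p. F (x, p) \<partial>\<gamma>) = 0"
    and B [measurable]: "B \<in> borel_measurable borel" and B2: "integrable \<gamma> (\<lambda>p. (B p)\<^sup>2)"
    and bound: "\<And>x p. \<bar>F (x, p)\<bar> \<le> B p"
  shows "AE \<omega> in M. (\<lambda>q. (\<Sum>i\<in>generation q. F (X i \<omega>, noise i \<omega>)) / 2 ^ q) \<longlonglongrightarrow> 0"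
proof -
  define b where "b = (\<integral>p. (B p)\<^sup>2 \<partial>\<gamma>)"
  define U where "U i \<omega> = F (X i \<omega>, noise i \<omega>)" for i \<omega>
  define D where "D q \<omega> = (\<Sum>i\<in>generation q. U i \<omega>) / 2 ^ q" for q \<omega>
  have b_nonneg: "b \<ge> 0" unfolding b_def by (intro Bochner_Integration.integral_nonneg) simp
  have U_measurable [measurable]: "U i \<in> borel_measurable M" if "i \<ge> 1" for i
    unfolding U_def[abs_def] using that
    by (intro measurable_compose[OF _ F] borel_measurable_Pair) auto
  have B_integrable: "integrable M (\<lambda>\<omega>. (B (noise i \<omega>))\<^sup>2)"
    and B_expectation: "expectation (\<lambda>\<omega>. (B (noise i \<omega>))\<^sup>2) = b" if "i \<ge> 1" for i
    using B2 noise_measurable[OF that] unfolding b_def distr_noise[OF that, symmetric]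
    by (simp_all add: integrable_distr_eq integral_distr)
  have U_le: "(U i \<omega>)\<^sup>2 \<le> (B (noise i \<omega>))\<^sup>2" for i \<omega>
    using bound[of "X i \<omega>" "noise i \<omega>"] unfolding U_def by (intro abs_le_square_iff[THEN iffD1]) auto
  have U2_integrable: "integrable M (\<lambda>\<omega>. (U i \<omega>)\<^sup>2)" if "i \<ge> 1" for i
    using U_le U_measurable[OF that]
    by (intro Bochner_Integration.integrable_bound[OF B_integrable[OF that]]) auto
  have U2_le: "expectation (\<lambda>\<omega>. (U i \<omega>)\<^sup>2) \<le> b" if "i \<ge> 1" for i
    unfolding B_expectation[OF that, symmetric]
    by (intro integral_mono U2_integrable B_integrable U_le that)
  have UU_integrable: "integrable M (\<lambda>\<omega>. U i \<omega> * U j \<omega>)" if "i \<ge> 1" "j \<ge> 1" for i j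
  proof (rule Bochner_Integration.integrable_bound)
    show "integrable M (\<lambda>\<omega>. (U i \<omega>)\<^sup>2 + (U j \<omega>)\<^sup>2)"
      by (intro Bochner_Integration.integrable_add U2_integrable that)
    show "AE \<omega> in M. norm (U i \<omega> * U j \<omega>) \<le> norm ((U i \<omega>)\<^sup>2 + (U j \<omega>)\<^sup>2)"
    proof (intro AE_I2)
      fix \<omega>
      have "2 * (\<bar>U i \<omega>\<bar> * \<bar>U j \<omega>\<bar>) \<le> (U i \<omega>)\<^sup>2 + (U j \<omega>)\<^sup>2"
        using zero_le_power2[of "\<bar>U i \<omega>\<bar> - \<bar>U j \<omega>\<bar>"] by (simp add: power2_diff)
      moreover have "0 \<le> \<bar>U i \<omega>\<bar> * \<bar>U j \<omega>\<bar>" by simp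
      ultimately show "norm (U i \<omega> * U j \<omega>) \<le> norm ((U i \<omega>)\<^sup>2 + (U j \<omega>)\<^sup>2)"
        unfolding real_norm_def abs_mult by linarith
    qed
  qed (use that in measurable)
  have D2: "(D q \<omega>)\<^sup>2 = (\<Sum>i\<in>generation q. \<Sum>j\<in>generation q. U i \<omega> * U j \<omega>) / 4 ^ q" for q \<omega>
  proof -
    have "((2::real) ^ q)\<^sup>2 = 4 ^ q" by (simp add: power2_eq_square flip: power_mult_distrib)
    then show ?thesis
      by (simp add: D_def power_divide) (simp add: power2_eq_square sum_product)
  qed
  have D2_integrable: "integrable M (\<lambda>\<omega>. (D q \<omega>)\<^sup>2)" for q
    unfolding D2 by (intro integrable_divide Bochner_Integration.integrable_sum UU_integrable generation_ge_1)
  have D2_le: "expectation (\<lambda>\<omega>. (D q \<omega>)\<^sup>2) \<le> b * (1 / 2) ^ q" for q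
  proof -
    have cross: "expectation (\<lambda>\<omega>. U i \<omega> * U j \<omega>) = (if i = j then expectation (\<lambda>\<omega>. (U i \<omega>)\<^sup>2) else 0)"
      if "i \<in> generation q" "j \<in> generation q" for i j
    proof (cases "i = j")
      case False
      then show ?thesis
        using expectation_product_zero[OF F centred that False]
          UU_integrable[OF generation_ge_1[OF that(1)] generation_ge_1[OF that(2)]]
        by (simp add: U_def)
    qed (simp add: power2_eq_square)
    have "expectation (\<lambda>\<omega>. (D q \<omega>)\<^sup>2)
        = (\<Sum>i\<in>generation q. \<Sum>j\<in>generation q. expectation (\<lambda>\<omega>. U i \<omega> * U j \<omega>)) / 4 ^ q"
    proof -
      have "expectation (\<lambda>\<omega>. \<Sum>i\<in>generation q. \<Sum>j\<in>generation q. U i \<omega> * U j \<omega>)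
          = (\<Sum>i\<in>generation q. expectation (\<lambda>\<omega>. \<Sum>j\<in>generation q. U i \<omega> * U j \<omega>))"
        by (intro Bochner_Integration.integral_sum Bochner_Integration.integrable_sum UU_integrable generation_ge_1)
      also have "\<dots> = (\<Sum>i\<in>generation q. \<Sum>j\<in>generation q. expectation (\<lambda>\<omega>. U i \<omega> * U j \<omega>))"
        by (intro sum.cong refl Bochner_Integration.integral_sum UU_integrable generation_ge_1)
      finally show ?thesis unfolding D2 by simp
    qed
    also have "\<dots> = (\<Sum>i\<in>generation q. expectation (\<lambda>\<omega>. (U i \<omega>)\<^sup>2)) / 4 ^ q"
      by (simp add: cross sum.delta cong: sum.cong)
    also have "\<dots> \<le> (\<Sum>i\<in>generation q. b) / 4 ^ q"
      by (intro divide_right_mono sum_mono U2_le generation_ge_1) auto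
    \<comment> \<open>Only the 2^q diagonal terms survive, against the squared normalization
      4^q.\<close>
    also have "\<dots> = b * (2 / 4) ^ q"
      by (simp only: power_divide sum_constant card_generation of_nat_power of_nat_numeral) simp
    finally show ?thesis by simp
  qed
  have [measurable]: "D q \<in> borel_measurable M" for q
    unfolding D_def[abs_def] by (intro borel_measurable_divide borel_measurable_sum U_measurable generation_ge_1) auto
  have "(\<integral>\<^sup>+\<omega>. (\<Sum>q. ennreal ((D q \<omega>)\<^sup>2)) \<partial>M) = (\<Sum>q. \<integral>\<^sup>+\<omega>. ennreal ((D q \<omega>)\<^sup>2) \<partial>M)"
    by (rule nn_integral_suminf) measurable
  also have "\<dots> \<le> (\<Sum>q. ennreal (b * (1 / 2) ^ q))"
  proof (intro suminf_le allI)
    fix q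
    show "(\<integral>\<^sup>+\<omega>. ennreal ((D q \<omega>)\<^sup>2) \<partial>M) \<le> ennreal (b * (1 / 2) ^ q)"
      using D2_le[of q] by (subst nn_integral_eq_integral[OF D2_integrable]) (simp_all add: ennreal_leI)
  qed auto
  also have "\<dots> = ennreal (\<Sum>q. b * (1 / 2) ^ q)"
    using b_nonneg by (intro suminf_ennreal2 summable_mult summable_geometric) auto
  finally have "(\<integral>\<^sup>+\<omega>. (\<Sum>q. ennreal ((D q \<omega>)\<^sup>2)) \<partial>M) \<noteq> \<infinity>"
    unfolding infinity_ennreal_def by (rule neq_top_trans[OF ennreal_neq_top])
  \<comment> \<open>Finite expectation makes the series of squares finite almost surely, which
    forces its terms to 0.\<close>
  then have "AE \<omega> in M. (\<Sum>q. ennreal ((D q \<omega>)\<^sup>2)) \<noteq> \<infinity>"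
    by (rule nn_integral_PInf_AE[rotated]) measurable
  then show ?thesis
  proof eventually_elim
    case (elim \<omega>)
    then have "summable (\<lambda>q. (D q \<omega>)\<^sup>2)"
      unfolding infinity_ennreal_def by (rule summable_suminf_not_top[rotated]) simp
    from tendsto_real_sqrt[OF summable_LIMSEQ_zero[OF this]]
    have "(\<lambda>q. \<bar>D q \<omega>\<bar>) \<longlonglongrightarrow> 0" by simp
    then have "(\<lambda>q. D q \<omega>) \<longlonglongrightarrow> 0" by (rule tendsto_rabs_zero_cancel)
    then show ?case by (simp add: D_def U_def)
  qed
qed

text \<open>The fluctuations of \<open>B\<close> around its mean \<open>c\<close> vanish, so the
  averages converge to \<open>c\<close>. Only boundedness is kept, as a random additive term for the
  moment recursion.\<close>

lemma noise_average_bounded: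
  fixes B :: "real \<times> real \<Rightarrow> real"
  assumes B [measurable]: "B \<in> borel_measurable borel" and B1: "integrable \<gamma> B"
    and B2: "integrable \<gamma> (\<lambda>p. (B p)\<^sup>2)" and nonneg: "\<And>p. 0 \<le> B p"
  shows "AE \<omega> in M. \<exists>K. \<forall>q. average (generation q) B (\<lambda>i. noise i \<omega>) \<le> K"
proof -
  interpret g: prob_space \<gamma> by (rule prob_space_\<gamma>)
  define c where "c = integral\<^sup>L \<gamma> B"
  have "0 \<le> c" unfolding c_def using nonneg by simp
  have "AE \<omega> in M. (\<lambda>q. (\<Sum>i\<in>generation q. (\<lambda>t. B (snd t) - c) (X i \<omega>, noise i \<omega>)) / 2 ^ q) \<longlonglongrightarrow> 0"
  proof (rule fluctuation_tendsto_0[where B = "\<lambda>p. B p + c"])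
    show "(\<integral>p. B (snd (x, p)) - c \<partial>\<gamma>) = 0" for x :: real
      using B1 g.prob_space by (simp add: c_def)
    show "integrable \<gamma> (\<lambda>p. (B p + c)\<^sup>2)"
      using B1 B2 by (simp add: power2_sum)
    show "\<bar>B (snd (x, p)) - c\<bar> \<le> B p + c" for x :: real and p
      using nonneg[of p] \<open>0 \<le> c\<close> by simp
  qed (simp_all del: borel_prod)
  then show ?thesis
  proof eventually_elim
    case (elim \<omega>)
    have "(\<Sum>i\<in>generation q. (\<lambda>t. B (snd t) - c) (X i \<omega>, noise i \<omega>)) / 2 ^ q
        = average (generation q) B (\<lambda>i. noise i \<omega>) - c" for q
      by (simp add: average_generation sum_subtractf diff_divide_distrib)
    with elim have "(\<lambda>q. average (generation q) B (\<lambda>i. noise i \<omega>) - c) \<longlonglongrightarrow> 0" by simp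
    then have "(\<lambda>q. average (generation q) B (\<lambda>i. noise i \<omega>)) \<longlonglongrightarrow> c"
      by (rule LIM_zero_cancel)
    from convergent_imp_Bseq[OF convergentI[OF this]]
    obtain K where "\<forall>q. norm (average (generation q) B (\<lambda>i. noise i \<omega>)) \<le> K"
      by (rule BseqE)
    then have "\<forall>q. average (generation q) B (\<lambda>i. noise i \<omega>) \<le> K"
      by (simp add: abs_le_iff)
    then show ?case by (rule exI)
  qed
qed

text \<open>The entry \<open>1 / 2\<close> keeps the rate positive when both coefficients
  vanish.\<close>

definition rate :: real where
  "rate = max (1 / 2) (max \<bar>\<alpha>0\<bar> \<bar>\<alpha>1\<bar>)"

lemma rate: "0 < rate" "rate < 1" "\<bar>\<alpha>0\<bar> \<le> rate" "\<bar>\<alpha>1\<bar> \<le> rate"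
  using alpha0 alpha1 by (auto simp: rate_def)

text \<open>The sum is the convex combination of \<open>u\<close> and \<open>v / (1 - rate)\<close>
  with weights \<open>rate\<close> and \<open>1 - rate\<close>. Convexity keeps a coefficient below
  1 in front of \<open>u ^ k\<close>; the factor 2^k of \<open>power_add_le\<close> would destroy
  the contraction.\<close>

lemma affine_power_le:
  assumes u: "0 \<le> u" and v: "0 \<le> v"
  shows "(rate * u + v) ^ k \<le> rate * u ^ k + (1 - rate) * (v / (1 - rate)) ^ k"
proof -
  have convex: "convex_on {0::real..} (\<lambda>x. x ^ k)"
    by (cases "even k") (auto intro: convex_power_odd convex_on_subset[OF convex_power_even])
  have "((1 - rate) *\<^sub>R (v / (1 - rate)) + rate *\<^sub>R u) ^ k \<le> (1 - rate) * (v / (1 - rate)) ^ k + rate * u ^ k"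
    using rate u v by (intro convex_onD[OF convex]) auto
  then show ?thesis using rate by (simp add: add.commute)
qed

text \<open>For a fixed outcome the noise averages have a bound \<open>K\<close>, and the generation
  moments then obey an affine recursion with factor \<open>rate\<close>, started from the number |X
  1|^k.\<close>

theorem X_moments_bounded:
  "AE \<omega> in M. \<forall>k::nat. \<exists>K. \<forall>q. average (generation q) (\<lambda>x. \<bar>x\<bar> ^ k) (\<lambda>i. X i \<omega>) \<le> K"
proof (subst AE_all_countable, intro allI)
  fix k :: nat
  define b where "b = \<bar>\<beta>0\<bar> + \<bar>\<beta>1\<bar>"
  define N where "N p = (b + (\<bar>fst p\<bar> + \<bar>snd p\<bar>))" for p :: "real \<times> real"
  define B where "B p = (N p) ^ k" for p
  \<comment> \<open>What remains of the second term of \<open>affine_power_le\<close> once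
    \<open>N p ^ k\<close> is taken out.\<close>
  define C where "C = (1 - rate) * (1 / (1 - rate)) ^ k"
  have C: "C \<ge> 0" using rate by (simp add: C_def)
  have N_nonneg: "0 \<le> N p" for p by (simp add: N_def b_def)
  have step_le: "\<bar>\<alpha> * x + \<beta> + e\<bar> ^ k \<le> rate * \<bar>x\<bar> ^ k + C * B p"
    if "\<bar>\<alpha>\<bar> \<le> rate" "\<bar>\<beta>\<bar> + \<bar>e\<bar> \<le> N p" for \<alpha> x \<beta> e p
  proof -
    have "\<bar>\<alpha> * x\<bar> \<le> rate * \<bar>x\<bar>"
      unfolding abs_mult using that(1) by (intro mult_right_mono) auto
    then have "\<bar>\<alpha> * x + \<beta> + e\<bar> \<le> rate * \<bar>x\<bar> + N p" using that(2) by linarith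
    then have "\<bar>\<alpha> * x + \<beta> + e\<bar> ^ k \<le> (rate * \<bar>x\<bar> + N p) ^ k" by (intro power_mono) auto
    also have "\<dots> \<le> rate * \<bar>x\<bar> ^ k + (1 - rate) * (N p / (1 - rate)) ^ k"
      by (intro affine_power_le N_nonneg) simp
    finally show ?thesis by (simp add: C_def B_def power_divide)
  qed
  have [measurable]: "B \<in> borel_measurable borel"
    unfolding B_def[abs_def] N_def by measurable
  have "AE \<omega> in M. \<exists>K. \<forall>q. average (generation q) B (\<lambda>i. noise i \<omega>) \<le> K"
  proof (rule noise_average_bounded)
    show "integrable \<gamma> B"
      unfolding B_def[abs_def] N_def by (rule integrable_gauss2_power[OF sigma rho]) (simp add: b_def)
    have "integrable \<gamma> (\<lambda>p. N p ^ (k * 2))"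
      unfolding N_def by (rule integrable_gauss2_power[OF sigma rho]) (simp add: b_def)
    then show "integrable \<gamma> (\<lambda>p. (B p)\<^sup>2)"
      unfolding B_def by (simp add: power_mult)
  qed (auto simp: B_def N_nonneg)
  then show "AE \<omega> in M. \<exists>K. \<forall>q. average (generation q) (\<lambda>x. \<bar>x\<bar> ^ k) (\<lambda>i. X i \<omega>) \<le> K"
  proof (rule AE_mp, intro AE_I2 impI)
    fix \<omega> assume \<omega>: "\<omega> \<in> space M"
    define m where "m q = average (generation q) (\<lambda>x. \<bar>x\<bar> ^ k) (\<lambda>i. X i \<omega>)" for q
    assume "\<exists>K. \<forall>q. average (generation q) B (\<lambda>i. noise i \<omega>) \<le> K"
    then obtain K where K: "\<And>q. average (generation q) B (\<lambda>i. noise i \<omega>) \<le> K" by blast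
    have "0 \<le> average (generation 0) B (\<lambda>i. noise i \<omega>)"
      by (simp add: average_def sum_nonneg B_def N_nonneg)
    then have "0 \<le> K" using K[of 0] by linarith
    have rec: "m (Suc q) \<le> rate * m q + C * K" for q
    proof -
      let ?S = "\<Sum>i\<in>generation q. 2 * (rate * \<bar>X i \<omega>\<bar> ^ k + C * B (noise i \<omega>))"
      have "(\<Sum>i\<in>generation (Suc q). \<bar>X i \<omega>\<bar> ^ k)
          = (\<Sum>i\<in>generation q. \<bar>X (2 * i) \<omega>\<bar> ^ k + \<bar>X (2 * i + 1) \<omega>\<bar> ^ k)"
        by (rule sum_generation_Suc)
      also have "\<dots> \<le> ?S"
      proof (intro sum_mono)
        fix i assume "i \<in> generation q"
        then have i: "i \<ge> 1" by (rule generation_ge_1)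
        have "\<bar>X (2 * i) \<omega>\<bar> ^ k \<le> rate * \<bar>X i \<omega>\<bar> ^ k + C * B (noise i \<omega>)"
          unfolding X_even[OF i \<omega>] by (intro step_le rate) (simp add: N_def b_def noise_def)
        moreover have "\<bar>X (2 * i + 1) \<omega>\<bar> ^ k \<le> rate * \<bar>X i \<omega>\<bar> ^ k + C * B (noise i \<omega>)"
          unfolding X_odd[OF i \<omega>] by (intro step_le rate) (simp add: N_def b_def noise_def)
        ultimately show "\<bar>X (2 * i) \<omega>\<bar> ^ k + \<bar>X (2 * i + 1) \<omega>\<bar> ^ k
            \<le> 2 * (rate * \<bar>X i \<omega>\<bar> ^ k + C * B (noise i \<omega>))"
          unfolding mult_2[of "rate * \<bar>X i \<omega>\<bar> ^ k + C * B (noise i \<omega>)"] by (rule add_mono)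
      qed
      finally have "m (Suc q) \<le> ?S / 2 ^ Suc q"
        unfolding m_def average_generation by (rule divide_right_mono) simp
      \<comment> \<open>Both daughters have the same bound; the resulting factor 2 cancels against
        the doubled size of the generation.\<close>
      also have "?S / 2 ^ Suc q = rate * m q + C * average (generation q) B (\<lambda>i. noise i \<omega>)"
        by (simp add: m_def average_generation sum.distrib sum_distrib_left[symmetric] add_divide_distrib)
      also have "\<dots> \<le> rate * m q + C * K" using K C by (intro add_left_mono mult_left_mono)
      finally show ?thesis .
    qed
    have "m q \<le> m 0 + C * K / (1 - rate)" for q
      using rate C \<open>0 \<le> K\<close> rec
      by (intro affine_recursion_bound) (auto simp: m_def average_def sum_nonneg)
    then show "\<exists>K. \<forall>q. average (generation q) (\<lambda>x. \<bar>x\<bar> ^ k) (\<lambda>i. X i \<omega>) \<le> K"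
      unfolding m_def by blast
  qed
qed

end

section \<open>The contraction of the induced chain\<close>

lemma abs_mean_le:
  fixes a b :: real
  shows "\<bar>a\<bar> \<le> C \<Longrightarrow> \<bar>b\<bar> \<le> C \<Longrightarrow> \<bar>(a + b) / 2\<bar> \<le> C"
  by (auto simp: abs_le_iff field_simps)

lemma abs_mean_diff_le:
  fixes a b :: real
  shows "\<bar>a - a'\<bar> \<le> C \<Longrightarrow> \<bar>b - b'\<bar> \<le> C \<Longrightarrow> \<bar>(a + b) / 2 - (a' + b') / 2\<bar> \<le> C"
  using abs_mean_le[of "a - a'" C "b - b'"] by (simp add: diff_divide_distrib add_divide_distrib)

context bar_model
begin

text \<open>Separating the mother's value from the noise allows families with different mothers to
  be compared under the same noise.\<close>

definition family_map :: "real \<Rightarrow> real \<times> real \<Rightarrow> real \<times> real \<times> real" where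
  "family_map x p = (x, \<alpha>0 * x + \<beta>0 + fst p, \<alpha>1 * x + \<beta>1 + snd p)"

lemma mother_daughters_eq:
  "i \<ge> 1 \<Longrightarrow> \<omega> \<in> space M \<Longrightarrow> mother_daughters X \<omega> i = family_map (X i \<omega>) (noise i \<omega>)"
  using X_even X_odd by (simp add: mother_daughters_def family_map_def noise_def)

lemma family_map_continuous: "continuous_on UNIV (\<lambda>(x, p). family_map x p)"
  unfolding family_map_def case_prod_beta by (intro continuous_intros)

lemma family_map_measurable [measurable]:
  "(\<lambda>(x, p). family_map x p) \<in> borel_measurable (borel \<Otimes>\<^sub>M borel)"
  unfolding borel_prod by (rule borel_measurable_continuous_onI[OF family_map_continuous])

lemma dist_family_map_le:
  "dist (family_map x p) (family_map y p) \<le> 3 * dist x y"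
proof -
  have "dist (family_map x p) (family_map y p)
      = norm (x - y, \<alpha>0 * (x - y), \<alpha>1 * (x - y))"
    by (simp add: family_map_def dist_norm algebra_simps)
  also have "\<dots> \<le> \<bar>x - y\<bar> + (\<bar>\<alpha>0 * (x - y)\<bar> + \<bar>\<alpha>1 * (x - y)\<bar>)"
    using norm_Pair_le[of "x - y" "(\<alpha>0 * (x - y), \<alpha>1 * (x - y))"]
      norm_Pair_le[of "\<alpha>0 * (x - y)" "\<alpha>1 * (x - y)"] by simp
  \<comment> \<open>Each of the three coordinates moves by at most the distance of the mothers,
    whence the constant 3.\<close>
  also have "\<dots> \<le> \<bar>x - y\<bar> + (1 * \<bar>x - y\<bar> + 1 * \<bar>x - y\<bar>)"
    unfolding abs_mult using alpha0 alpha1 by (intro add_mono mult_right_mono order_refl) auto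
  finally show ?thesis by (simp add: dist_real_def)
qed

text \<open>This is \<open>P f\<close>, with the conditional law written as a translate of the
  centred noise law, so that \<open>x\<close> enters through the integrand only.\<close>

definition family_mean :: "(real \<times> real \<times> real \<Rightarrow> real) \<Rightarrow> real \<Rightarrow> real" where
  "family_mean f x = (\<integral>p. f (family_map x p) \<partial>\<gamma>)"

text \<open>The transition operator of the induced chain: the half-sum over the daughters integrates
  out the fair coin that selects one of them.\<close>

definition chain_op :: "(real \<Rightarrow> real) \<Rightarrow> real \<Rightarrow> real" where
  "chain_op g = family_mean (\<lambda>(x, y, z). (g y + g z) / 2)"

section \<open>Regularity of conditional means\<close>

lemma borel_measurable_family_map:
  assumes "f \<in> borel_measurable borel"
  shows "(\<lambda>p. f (family_map x p)) \<in> borel_measurable borel"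
proof -
  have "family_map x \<in> borel_measurable borel"
    unfolding family_map_def by (intro borel_measurable_continuous_onI continuous_intros)
  then show ?thesis using assms by (rule measurable_compose)
qed

lemma integrable_family_map:
  assumes "bounded_lipschitz f"
  shows "integrable \<gamma> (\<lambda>p. f (family_map x p))"
proof -
  interpret g: prob_space \<gamma> by (rule prob_space_\<gamma>)
  obtain B where "\<And>u. \<bar>f u\<bar> \<le> B" using assms by (auto simp: bounded_lipschitz_def)
  then show ?thesis
    using borel_measurable_family_map[OF bounded_lipschitz_measurable[OF assms], of x]
    by (intro g.integrable_const_bound[of _ B]) auto
qed

lemma abs_family_mean_le:
  assumes "bounded_lipschitz f" "\<And>u. \<bar>f u\<bar> \<le> B"
  shows "\<bar>family_mean f x\<bar> \<le> B"
proof -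
  interpret g: prob_space \<gamma> by (rule prob_space_\<gamma>)
  have "\<bar>family_mean f x\<bar> \<le> (\<integral>p. \<bar>f (family_map x p)\<bar> \<partial>\<gamma>)"
    unfolding family_mean_def by (rule integral_abs_bound)
  also have "\<dots> \<le> (\<integral>p. B \<partial>\<gamma>)"
    using assms integrable_family_map[OF assms(1)] by (intro integral_mono) auto
  finally show ?thesis using g.prob_space by simp
qed

text \<open>Synchronous coupling: both means are integrals over one noise variable, so a bound for
  each common \<open>p\<close> suffices.\<close>

lemma abs_family_mean_diff_le:
  assumes "bounded_lipschitz f" "\<And>p. \<bar>f (family_map x p) - f (family_map y p)\<bar> \<le> C"
  shows "\<bar>family_mean f x - family_mean f y\<bar> \<le> C"
proof -
  interpret g: prob_space \<gamma> by (rule prob_space_\<gamma>)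
  have "family_mean f x - family_mean f y = (\<integral>p. f (family_map x p) - f (family_map y p) \<partial>\<gamma>)"
    unfolding family_mean_def
    by (intro Bochner_Integration.integral_diff[symmetric] integrable_family_map assms)
  also have "\<bar>\<dots>\<bar> \<le> (\<integral>p. \<bar>f (family_map x p) - f (family_map y p)\<bar> \<partial>\<gamma>)"
    by (rule integral_abs_bound)
  also have "\<dots> \<le> (\<integral>p. C \<partial>\<gamma>)"
    using assms integrable_family_map[OF assms(1)] by (intro integral_mono) auto
  finally show ?thesis using g.prob_space by simp
qed

lemma bounded_lipschitz_family_mean:
  assumes f: "bounded_lipschitz f"
  shows "bounded_lipschitz (family_mean f)"
proof -
  obtain B where B: "\<And>u. \<bar>f u\<bar> \<le> B"
    using f by (auto simp: bounded_lipschitz_def)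
  obtain L where L: "L \<ge> 0" "\<And>u v. \<bar>f u - f v\<bar> \<le> L * dist u v"
    using f by (auto simp: bounded_lipschitz_def)
  have "\<bar>family_mean f x - family_mean f y\<bar> \<le> (L * 3) * dist x y" for x y
  proof (intro abs_family_mean_diff_le f)
    fix p
    have "\<bar>f (family_map x p) - f (family_map y p)\<bar> \<le> L * dist (family_map x p) (family_map y p)"
      by (rule L(2))
    also have "\<dots> \<le> L * (3 * dist x y)"
      using L(1) dist_family_map_le by (rule mult_left_mono[rotated])
    finally show "\<bar>f (family_map x p) - f (family_map y p)\<bar> \<le> (L * 3) * dist x y" by simp
  qed
  moreover have "0 \<le> L * 3" using L(1) by simp
  moreover have "\<bar>family_mean f x\<bar> \<le> B" for x
    by (rule abs_family_mean_le[OF f B])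
  ultimately show ?thesis unfolding bounded_lipschitz_def by blast
qed

lemma bounded_lipschitz_daughters:
  assumes g: "bounded_lipschitz g"
  shows "bounded_lipschitz (\<lambda>(x::real, y::real, z::real). (g y + g z) / 2)"
proof -
  obtain B where B: "\<And>u. \<bar>g u\<bar> \<le> B"
    using g by (auto simp: bounded_lipschitz_def)
  obtain L where L: "L \<ge> 0" "\<And>u v. \<bar>g u - g v\<bar> \<le> L * dist u v"
    using g by (auto simp: bounded_lipschitz_def)
  have "\<bar>(g (fst (snd u)) + g (snd (snd u))) / 2 - (g (fst (snd v)) + g (snd (snd v))) / 2\<bar> \<le> L * dist u v"
    for u v :: "real \<times> real \<times> real"
  proof -
    have "dist (fst (snd u)) (fst (snd v)) \<le> dist u v" "dist (snd (snd u)) (snd (snd v)) \<le> dist u v"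
      using dist_fst_le[of "snd u" "snd v"] dist_snd_le[of "snd u" "snd v"] dist_snd_le[of u v] by auto
    then have "L * dist (fst (snd u)) (fst (snd v)) \<le> L * dist u v"
      "L * dist (snd (snd u)) (snd (snd v)) \<le> L * dist u v"
      using L(1) by (auto intro: mult_left_mono)
    then show ?thesis
      using L(2)[of "fst (snd u)" "fst (snd v)"] L(2)[of "snd (snd u)" "snd (snd v)"]
      by (intro abs_mean_diff_le) (auto intro: order_trans)
  qed
  moreover have "\<bar>(g (fst (snd u)) + g (snd (snd u))) / 2\<bar> \<le> B" for u :: "real \<times> real \<times> real"
    by (intro abs_mean_le B)
  ultimately show ?thesis
    unfolding bounded_lipschitz_def case_prod_beta using L(1) by blast
qed

section \<open>Iterates of the transition operator\<close>

lemma bounded_lipschitz_chain_op: "bounded_lipschitz g \<Longrightarrow> bounded_lipschitz (chain_op g)"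
  unfolding chain_op_def by (intro bounded_lipschitz_family_mean bounded_lipschitz_daughters)

lemma abs_chain_op_le:
  assumes g: "bounded_lipschitz g" and B: "\<And>u. \<bar>g u\<bar> \<le> B"
  shows "\<bar>chain_op g x\<bar> \<le> B"
  unfolding chain_op_def
proof (rule abs_family_mean_le[OF bounded_lipschitz_daughters[OF g]])
  fix u :: "real \<times> real \<times> real"
  show "\<bar>case u of (x, y, z) \<Rightarrow> (g y + g z) / 2\<bar> \<le> B"
    unfolding case_prod_beta by (intro abs_mean_le B)
qed

text \<open>Under common noise, corresponding daughters differ by exactly \<alpha> (x - y):
  intercept and noise cancel.\<close>

lemma chain_op_contraction:
  assumes g: "bounded_lipschitz g" and L: "L \<ge> 0" "\<And>u v. \<bar>g u - g v\<bar> \<le> L * \<bar>u - v\<bar>"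
  shows "\<bar>chain_op g x - chain_op g y\<bar> \<le> (L * rate) * \<bar>x - y\<bar>"
  unfolding chain_op_def
proof (rule abs_family_mean_diff_le[OF bounded_lipschitz_daughters[OF g]])
  fix p :: "real \<times> real"
  have "\<bar>g (\<alpha> * x + \<beta> + e) - g (\<alpha> * y + \<beta> + e)\<bar> \<le> (L * rate) * \<bar>x - y\<bar>" if "\<bar>\<alpha>\<bar> \<le> rate" for \<alpha> \<beta> e
  proof -
    have "\<bar>g (\<alpha> * x + \<beta> + e) - g (\<alpha> * y + \<beta> + e)\<bar> \<le> L * \<bar>\<alpha> * (x - y)\<bar>"
      using L(2)[of "\<alpha> * x + \<beta> + e" "\<alpha> * y + \<beta> + e"] by (simp add: algebra_simps)
    also have "\<dots> \<le> L * (rate * \<bar>x - y\<bar>)"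
      unfolding abs_mult using L(1) that by (intro mult_left_mono mult_right_mono) auto
    finally show ?thesis by simp
  qed
  from this[OF rate(3), of \<beta>0 "fst p"] this[OF rate(4), of \<beta>1 "snd p"]
  show "\<bar>(case family_map x p of (x, y, z) \<Rightarrow> (g y + g z) / 2) -
      (case family_map y p of (x, y, z) \<Rightarrow> (g y + g z) / 2)\<bar> \<le> (L * rate) * \<bar>x - y\<bar>"
    unfolding family_map_def prod.case by (rule abs_mean_diff_le)
qed

text \<open>The constant 3 L from \<open>bounded_lipschitz_family_mean\<close> would grow under
  iteration, so the sharp contraction is carried along. The three properties go through one
  induction because each application needs the regularity of the previous iterate.\<close>

lemma chain_op_iterate:
  assumes g: "bounded_lipschitz g" and B: "\<And>u. \<bar>g u\<bar> \<le> B"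
    and L: "L \<ge> 0" "\<And>u v. \<bar>g u - g v\<bar> \<le> L * \<bar>u - v\<bar>"
  shows "bounded_lipschitz ((chain_op ^^ k) g)" "\<bar>(chain_op ^^ k) g x\<bar> \<le> B"
    "\<bar>(chain_op ^^ k) g x - (chain_op ^^ k) g y\<bar> \<le> (L * rate ^ k) * \<bar>x - y\<bar>"
proof -
  have "bounded_lipschitz ((chain_op ^^ k) g) \<and> (\<forall>x. \<bar>(chain_op ^^ k) g x\<bar> \<le> B) \<and>
    (\<forall>x y. \<bar>(chain_op ^^ k) g x - (chain_op ^^ k) g y\<bar> \<le> (L * rate ^ k) * \<bar>x - y\<bar>)"
  proof (induction k)
    case 0
    then show ?case using assms by simp
  next
    case (Suc k)
    have "0 \<le> L * rate ^ k" using L(1) rate(1) by simp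
    with Suc have "\<bar>(chain_op ^^ Suc k) g x - (chain_op ^^ Suc k) g y\<bar> \<le> (L * rate ^ k * rate) * \<bar>x - y\<bar>" for x y
      unfolding funpow.simps comp_def by (intro chain_op_contraction) auto
    moreover have "\<bar>(chain_op ^^ Suc k) g x\<bar> \<le> B" for x
      using Suc unfolding funpow.simps comp_def by (intro abs_chain_op_le) auto
    moreover have "bounded_lipschitz ((chain_op ^^ Suc k) g)"
      using Suc unfolding funpow.simps comp_def by (intro bounded_lipschitz_chain_op) auto
    ultimately show ?case by (simp add: mult_ac)
  qed
  then show "bounded_lipschitz ((chain_op ^^ k) g)" "\<bar>(chain_op ^^ k) g x\<bar> \<le> B"
    "\<bar>(chain_op ^^ k) g x - (chain_op ^^ k) g y\<bar> \<le> (L * rate ^ k) * \<bar>x - y\<bar>"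
    by auto
qed

text \<open>The deviation of \<open>f\<close> from its mean over the noise is centred for each
  mother's value and bounded by \<open>2 * B\<close>, so the fluctuation result applies with a
  constant dominating function.\<close>

lemma average_families_minus_means:
  assumes f: "bounded_lipschitz f"
  shows "AE \<omega> in M. (\<lambda>q. average (generation q) f (mother_daughters X \<omega>)
    - average (generation q) (family_mean f) (\<lambda>i. X i \<omega>)) \<longlonglongrightarrow> 0"
proof -
  interpret g: prob_space \<gamma> by (rule prob_space_\<gamma>)
  obtain B where B: "\<And>u. \<bar>f u\<bar> \<le> B"
    using f by (auto simp: bounded_lipschitz_def)
  define F where "F = (\<lambda>(x, p). f (family_map x p) - family_mean f x)"
  have F_measurable: "F \<in> borel_measurable borel"
  proof -
    have "continuous_on UNIV (\<lambda>u. f (case u of (x, p) \<Rightarrow> family_map x p))"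
      by (rule continuous_on_compose2[OF bounded_lipschitz_continuous[OF f] family_map_continuous]) auto
    moreover have "continuous_on UNIV (\<lambda>u::real \<times> real \<times> real. family_mean f (fst u))"
      by (rule continuous_on_compose2[OF bounded_lipschitz_continuous[OF bounded_lipschitz_family_mean[OF f]]])
        (auto intro: continuous_intros)
    ultimately show ?thesis
      unfolding F_def case_prod_beta by (intro borel_measurable_continuous_onI continuous_on_diff)
  qed
  have "AE \<omega> in M. (\<lambda>q. (\<Sum>i\<in>generation q. F (X i \<omega>, noise i \<omega>)) / 2 ^ q) \<longlonglongrightarrow> 0"
  proof (rule fluctuation_tendsto_0[OF F_measurable, where B = "\<lambda>_. 2 * B"])
    show "(\<integral>p. F (x, p) \<partial>\<gamma>) = 0" for x
    proof -
      have "(\<integral>p. F (x, p) \<partial>\<gamma>) = (\<integral>p. f (family_map x p) \<partial>\<gamma>) - (\<integral>p. family_mean f x \<partial>\<gamma>)"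
        unfolding F_def prod.case
        by (rule Bochner_Integration.integral_diff[OF integrable_family_map[OF f] g.integrable_const])
      then show ?thesis using g.prob_space by (simp add: family_mean_def)
    qed
    show "\<bar>F (x, p)\<bar> \<le> 2 * B" for x p
      using B[of "family_map x p"] abs_family_mean_le[OF f B, of x] by (simp add: F_def)
  qed simp_all
  then show ?thesis
  proof (rule AE_mp, intro AE_I2 impI)
    fix \<omega> assume \<omega>: "\<omega> \<in> space M"
      and lim: "(\<lambda>q. (\<Sum>i\<in>generation q. F (X i \<omega>, noise i \<omega>)) / 2 ^ q) \<longlonglongrightarrow> 0"
    have "(\<Sum>i\<in>generation q. F (X i \<omega>, noise i \<omega>)) / 2 ^ q = average (generation q) f (mother_daughters X \<omega>)
      - average (generation q) (family_mean f) (\<lambda>i. X i \<omega>)" for q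
    proof -
      have "(\<Sum>i\<in>generation q. F (X i \<omega>, noise i \<omega>))
          = (\<Sum>i\<in>generation q. f (mother_daughters X \<omega> i) - family_mean f (X i \<omega>))"
        by (intro sum.cong refl) (simp add: F_def mother_daughters_eq[OF generation_ge_1 \<omega>])
      then show ?thesis
        by (simp add: average_generation sum_subtractf diff_divide_distrib)
    qed
    with lim show "(\<lambda>q. average (generation q) f (mother_daughters X \<omega>)
      - average (generation q) (family_mean f) (\<lambda>i. X i \<omega>)) \<longlonglongrightarrow> 0" by simp
  qed
qed

section \<open>Descent through the generations\<close>

lemma average_Suc_generation:
  "average (generation (Suc q)) g (\<lambda>i. X i \<omega>)
    = average (generation q) (\<lambda>(x, y, z). (g y + g z) / 2) (mother_daughters X \<omega>)"
  unfolding average_generation sum_generation_Suc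
  by (simp add: mother_daughters_def sum_divide_distrib)

text \<open>Going back one generation costs one application of \<open>chain_op\<close> and an error
  tending to 0. For fixed \<open>k\<close> only finitely many errors add up, and the null sets for
  all \<open>k\<close> are united before the induction.\<close>

lemma average_generation_shift:
  assumes g: "bounded_lipschitz g"
  shows "AE \<omega> in M. \<forall>k. (\<lambda>q. average (generation (q + k)) g (\<lambda>i. X i \<omega>)
    - average (generation q) ((chain_op ^^ k) g) (\<lambda>i. X i \<omega>)) \<longlonglongrightarrow> 0"
proof -
  have iter: "bounded_lipschitz ((chain_op ^^ k) g)" for k
    using g by (induction k) (auto intro: bounded_lipschitz_chain_op)
  have "AE \<omega> in M. (\<lambda>q. average (generation (Suc q)) ((chain_op ^^ k) g) (\<lambda>i. X i \<omega>)
    - average (generation q) ((chain_op ^^ Suc k) g) (\<lambda>i. X i \<omega>)) \<longlonglongrightarrow> 0" for k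
    using average_families_minus_means[OF bounded_lipschitz_daughters[OF iter[of k]]]
    unfolding average_Suc_generation by (simp add: chain_op_def)
  then have "AE \<omega> in M. \<forall>k. (\<lambda>q. average (generation (Suc q)) ((chain_op ^^ k) g) (\<lambda>i. X i \<omega>)
    - average (generation q) ((chain_op ^^ Suc k) g) (\<lambda>i. X i \<omega>)) \<longlonglongrightarrow> 0"
    unfolding AE_all_countable by (rule allI)
  then show ?thesis
  proof (eventually_elim, intro allI)
    fix \<omega> k
    define A where "A q j = average (generation q) ((chain_op ^^ j) g) (\<lambda>i. X i \<omega>)" for q j
    assume "\<forall>k. (\<lambda>q. average (generation (Suc q)) ((chain_op ^^ k) g) (\<lambda>i. X i \<omega>)
      - average (generation q) ((chain_op ^^ Suc k) g) (\<lambda>i. X i \<omega>)) \<longlonglongrightarrow> 0"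
    then have step: "(\<lambda>q. A (Suc q) k - A q (Suc k)) \<longlonglongrightarrow> 0" for k
      unfolding A_def by (rule spec)
    have "(\<lambda>q. A (q + k) 0 - A q k) \<longlonglongrightarrow> 0"
    proof (induction k)
      case (Suc k)
      \<comment> \<open>The induction hypothesis at \<open>Suc q\<close> reaches generation
        \<open>Suc q\<close> with iterate \<open>k\<close>; the one-step error then leads to
        generation \<open>q\<close> with iterate \<open>Suc k\<close>.\<close>
      from tendsto_add[OF LIMSEQ_Suc[OF Suc] step[of k]] show ?case by simp
    qed simp
    then show "(\<lambda>q. average (generation (q + k)) g (\<lambda>i. X i \<omega>)
      - average (generation q) ((chain_op ^^ k) g) (\<lambda>i. X i \<omega>)) \<longlonglongrightarrow> 0"
      by (simp add: A_def)
  qed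
qed

end

section \<open>The stationary distribution\<close>

locale stationary_bar_model = bar_model +
  fixes \<mu> :: "real measure"
  assumes stationary: "stationary_distribution (bar_Q \<alpha>0 \<beta>0 \<alpha>1 \<beta>1 \<sigma>) \<mu>"
begin

sublocale \<mu>: prob_space \<mu>
  using stationary by (simp add: stationary_distribution_def)

lemma sets_\<mu> [simp, measurable_cong]: "sets \<mu> = sets borel"
  using stationary by (simp add: stationary_distribution_def)

text \<open>The law of a family whose mother is drawn from \<open>\<mu>\<close>, independently of
  the noise. It is the limit of the empirical laws of families.\<close>

definition family_law :: "(real \<times> real \<times> real) measure" where
  "family_law = distr (\<mu> \<Otimes>\<^sub>M \<gamma>) borel (\<lambda>(x, p). family_map x p)"

lemma sets_family_law [simp, measurable_cong]: "sets family_law = sets borel"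
  by (simp add: family_law_def)

lemma family_map_measurable_product:
  "(\<lambda>(x, p). family_map x p) \<in> borel_measurable (\<mu> \<Otimes>\<^sub>M \<gamma>)"
proof -
  have "sets (\<mu> \<Otimes>\<^sub>M \<gamma>) = sets (borel \<Otimes>\<^sub>M borel)"
    by (intro sets_pair_measure_cong) simp_all
  from measurable_cong_sets[OF this refl] show ?thesis using family_map_measurable by blast
qed

lemma prob_space_family_law: "prob_space family_law"
proof -
  interpret g: prob_space \<gamma> by (rule prob_space_\<gamma>)
  interpret P: pair_prob_space \<mu> \<gamma> ..
  show ?thesis
    unfolding family_law_def by (rule P.prob_space_distr[OF family_map_measurable_product])
qed

lemma integral_family_law:
  assumes "integrable family_law f"
  shows "(\<integral>t. f t \<partial>family_law) = (\<integral>x. family_mean f x \<partial>\<mu>)"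
proof -
  interpret g: prob_space \<gamma> by (rule prob_space_\<gamma>)
  interpret P: pair_sigma_finite \<mu> \<gamma> ..
  have f: "f \<in> borel_measurable borel"
    using assms by (auto cong: measurable_cong_sets)
  have eq: "f (case u of (x, p) \<Rightarrow> family_map x p) = (case u of (x, p) \<Rightarrow> f (family_map x p))" for u
    by (simp add: case_prod_beta)
  have "integrable (\<mu> \<Otimes>\<^sub>M \<gamma>) (\<lambda>(x, p). f (family_map x p))"
    using assms unfolding family_law_def
    by (subst (asm) integrable_distr_eq[OF family_map_measurable_product f]) (simp add: eq)
  from P.integral_fst[OF this] show ?thesis
    unfolding family_law_def
    by (subst integral_distr[OF family_map_measurable_product f]) (simp add: eq family_mean_def[abs_def])
qed

lemma nn_integral_family_law:
  assumes f: "f \<in> borel_measurable borel"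
  shows "(\<integral>\<^sup>+t. f t \<partial>family_law) = (\<integral>\<^sup>+x. \<integral>\<^sup>+p. f (family_map x p) \<partial>\<gamma> \<partial>\<mu>)"
    and "(\<lambda>x. \<integral>\<^sup>+p. f (family_map x p) \<partial>\<gamma>) \<in> borel_measurable \<mu>"
proof -
  interpret g: prob_space \<gamma> by (rule prob_space_\<gamma>)
  have eq: "f (case u of (x, p) \<Rightarrow> family_map x p) = (case u of (x, p) \<Rightarrow> f (family_map x p))" for u
    by (simp add: case_prod_beta)
  have meas: "(\<lambda>(x, p). f (family_map x p)) \<in> borel_measurable (\<mu> \<Otimes>\<^sub>M \<gamma>)"
    using measurable_compose[OF family_map_measurable_product f] unfolding eq .
  show "(\<lambda>x. \<integral>\<^sup>+p. f (family_map x p) \<partial>\<gamma>) \<in> borel_measurable \<mu>"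
    using g.borel_measurable_nn_integral[OF meas] by simp
  show "(\<integral>\<^sup>+t. f t \<partial>family_law) = (\<integral>\<^sup>+x. \<integral>\<^sup>+p. f (family_map x p) \<partial>\<gamma> \<partial>\<mu>)"
    unfolding family_law_def
    by (subst nn_integral_distr[OF family_map_measurable_product])
      (use f meas in \<open>simp_all add: eq g.nn_integral_fst[symmetric]\<close>)
qed

text \<open>Links the translated noise in \<open>family_map\<close> to the Gaussian laws in
  \<open>bar_Q\<close>: either coordinate of the noise has the same centred marginal.\<close>

lemma nn_integral_noise_shift:
  assumes A [measurable]: "A \<in> sets borel"
  shows "(\<integral>\<^sup>+p. indicator A (c + fst p) \<partial>\<gamma>) = emeasure (gauss c \<sigma>) A"
    and "(\<integral>\<^sup>+p. indicator A (c + snd p) \<partial>\<gamma>) = emeasure (gauss c \<sigma>) A"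
proof -
  have shift: "emeasure (gauss c \<sigma>) A = (\<integral>\<^sup>+y. indicator A (c + y) \<partial>gauss 0 \<sigma>)"
  proof -
    have "emeasure (gauss c \<sigma>) A = (\<integral>\<^sup>+y. indicator A y \<partial>distr (gauss 0 \<sigma>) borel (\<lambda>y. c + y))"
      by (simp add: distr_gauss_shift[OF sigma])
    also have "\<dots> = (\<integral>\<^sup>+y. indicator A (c + y) \<partial>gauss 0 \<sigma>)"
      by (rule nn_integral_distr) measurable
    finally show ?thesis .
  qed
  have "(\<integral>\<^sup>+y. indicator A (c + y) \<partial>distr \<gamma> borel fst) = (\<integral>\<^sup>+p. indicator A (c + fst p) \<partial>\<gamma>)"
    by (rule nn_integral_distr) measurable
  then show "(\<integral>\<^sup>+p. indicator A (c + fst p) \<partial>\<gamma>) = emeasure (gauss c \<sigma>) A"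
    by (simp add: shift distr_gauss2_fst[OF sigma rho])
  have "(\<integral>\<^sup>+y. indicator A (c + y) \<partial>distr \<gamma> borel snd) = (\<integral>\<^sup>+p. indicator A (c + snd p) \<partial>\<gamma>)"
    by (rule nn_integral_distr) measurable
  then show "(\<integral>\<^sup>+p. indicator A (c + snd p) \<partial>\<gamma>) = emeasure (gauss c \<sigma>) A"
    by (simp add: shift distr_gauss2_snd[OF sigma rho])
qed

section \<open>Invariance extended from sets to functions\<close>

lemma half_add_half: "2 * (1 / 2 * u + 1 / 2 * v) = u + v" for u v :: ennreal
proof -
  have "2 * (1 / 2 * w) = w" for w :: ennreal
    by (simp add: mult.assoc[symmetric] ennreal_times_divide ennreal_divide_self)
  then show ?thesis by (simp add: distrib_left)
qed

text \<open>Stationarity is given on Borel sets; approximation by simple functions extends it to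
  nonnegative measurable functions. The sum over the two daughters, rather than the half-sum, keeps
  division of extended reals out of the induction.\<close>

lemma nn_integral_daughters:
  assumes "u \<in> borel_measurable borel"
  shows "(\<integral>\<^sup>+t. u (fst (snd t)) \<partial>family_law) + (\<integral>\<^sup>+t. u (snd (snd t)) \<partial>family_law) = 2 * (\<integral>\<^sup>+x. u x \<partial>\<mu>)"
  using assms
proof (induction rule: borel_measurable_induct)
  case (cong f g)
  then have "f = g" by auto
  then show ?case using cong by simp
next
  case (set A)
  then have [measurable]: "A \<in> sets borel" by simp
  let ?a = "\<lambda>x. emeasure (gauss (\<alpha>0 * x + \<beta>0) \<sigma>) A"
  let ?b = "\<lambda>x. emeasure (gauss (\<alpha>1 * x + \<beta>1) \<sigma>) A"
  have a: "(\<integral>\<^sup>+t. indicator A (fst (snd t)) \<partial>family_law) = (\<integral>\<^sup>+x. ?a x \<partial>\<mu>)" "?a \<in> borel_measurable \<mu>"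
    using nn_integral_family_law[of "\<lambda>t. indicator A (fst (snd t))"]
    by (simp_all add: family_map_def nn_integral_noise_shift)
  have b: "(\<integral>\<^sup>+t. indicator A (snd (snd t)) \<partial>family_law) = (\<integral>\<^sup>+x. ?b x \<partial>\<mu>)" "?b \<in> borel_measurable \<mu>"
    using nn_integral_family_law[of "\<lambda>t. indicator A (snd (snd t))"]
    by (simp_all add: family_map_def nn_integral_noise_shift)
  have "emeasure \<mu> A = (\<integral>\<^sup>+x. 1 / 2 * ?a x + 1 / 2 * ?b x \<partial>\<mu>)"
    using stationary by (simp add: stationary_distribution_def bar_Q_def)
  also have "\<dots> = 1 / 2 * (\<integral>\<^sup>+x. ?a x \<partial>\<mu>) + 1 / 2 * (\<integral>\<^sup>+x. ?b x \<partial>\<mu>)"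
    using a(2) b(2) by (subst nn_integral_add) (simp_all add: nn_integral_cmult)
  finally have "2 * emeasure \<mu> A = (\<integral>\<^sup>+x. ?a x \<partial>\<mu>) + (\<integral>\<^sup>+x. ?b x \<partial>\<mu>)"
    by (simp only: half_add_half)
  then show ?case by (simp add: a(1) b(1))
next
  case (mult u c)
  then have [measurable]: "u \<in> borel_measurable borel" by simp
  show ?case
    using mult by (simp add: nn_integral_cmult distrib_left[symmetric] mult.left_commute)
next
  case (add u v)
  then have [measurable]: "u \<in> borel_measurable borel" "v \<in> borel_measurable borel" by simp_all
  show ?case
    using add by (simp add: nn_integral_add distrib_left add_ac)
next
  case (seq U)
  then have [measurable]: "U i \<in> borel_measurable borel" for i by simp
  have mono: "incseq (\<lambda>i. \<integral>\<^sup>+t. U i (h t) \<partial>N)" for h :: "'c \<Rightarrow> real" and N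
    using seq by (intro monoI nn_integral_mono) (auto simp: incseq_def le_fun_def)
  have inc: "incseq (\<lambda>i t. U i (h t))" for h :: "'c \<Rightarrow> real"
    using seq by (auto simp: incseq_def le_fun_def)
  have "(\<integral>\<^sup>+t. (\<Squnion>i. U i (fst (snd t))) \<partial>family_law) + (\<integral>\<^sup>+t. (\<Squnion>i. U i (snd (snd t))) \<partial>family_law)
      = (\<Squnion>i. \<integral>\<^sup>+t. U i (fst (snd t)) \<partial>family_law) + (\<Squnion>i. \<integral>\<^sup>+t. U i (snd (snd t)) \<partial>family_law)"
    by (intro arg_cong2[where f = "(+)"] nn_integral_monotone_convergence_SUP inc) measurable
  also have "\<dots> = (\<Squnion>i. (\<integral>\<^sup>+t. U i (fst (snd t)) \<partial>family_law) + (\<integral>\<^sup>+t. U i (snd (snd t)) \<partial>family_law))"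
    by (intro ennreal_SUP_add[symmetric] mono)
  also have "\<dots> = 2 * (\<Squnion>i. \<integral>\<^sup>+x. U i x \<partial>\<mu>)"
    using seq by (simp add: SUP_mult_left_ennreal)
  also have "(\<Squnion>i. \<integral>\<^sup>+x. U i x \<partial>\<mu>) = (\<integral>\<^sup>+x. (\<Squnion>i. U i x) \<partial>\<mu>)"
    using seq by (intro nn_integral_monotone_convergence_SUP[symmetric]) simp_all
  finally show ?case by (simp add: image_comp)
qed

lemma integrable_bounded_lipschitz:
  assumes g: "bounded_lipschitz g" and "prob_space N" and h: "h \<in> borel_measurable N"
  shows "integrable N (\<lambda>t. g (h t))"
proof -
  interpret N: prob_space N by fact
  obtain B where "\<And>u. \<bar>g u\<bar> \<le> B" using g by (auto simp: bounded_lipschitz_def)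
  then show ?thesis
    using measurable_compose[OF h bounded_lipschitz_measurable[OF g]]
    by (intro N.integrable_const_bound[of _ B]) auto
qed

text \<open>Adding the bound \<open>B\<close> makes \<open>g\<close> nonnegative, so that
  \<open>nn_integral_daughters\<close> applies. All measures involved have mass 1, so the added
  constants cancel.\<close>

lemma integral_chain_op:
  assumes g: "bounded_lipschitz g"
  shows "(\<integral>x. chain_op g x \<partial>\<mu>) = (\<integral>x. g x \<partial>\<mu>)"
proof -
  interpret T: prob_space family_law by (rule prob_space_family_law)
  obtain B where B: "\<And>u. \<bar>g u\<bar> \<le> B" using g by (auto simp: bounded_lipschitz_def)
  have nonneg: "0 \<le> g u + B" for u using B[of u] by linarith
  note [measurable] = bounded_lipschitz_measurable[OF g]
  have shift: "(\<integral>\<^sup>+t. ennreal (g (h t) + B) \<partial>N) = ennreal ((\<integral>t. g (h t) \<partial>N) + B)"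
      "0 \<le> (\<integral>t. g (h t) \<partial>N) + B"
    if N: "prob_space N" and h: "h \<in> borel_measurable N" for N :: "'c measure" and h
  proof -
    interpret N: prob_space N by fact
    have "integrable N (\<lambda>t. g (h t))" by (rule integrable_bounded_lipschitz[OF g N h])
    then have int: "integrable N (\<lambda>t. g (h t) + B)"
      and eq: "(\<integral>t. g (h t) + B \<partial>N) = (\<integral>t. g (h t) \<partial>N) + B"
      using N.prob_space by simp_all
    show "(\<integral>\<^sup>+t. ennreal (g (h t) + B) \<partial>N) = ennreal ((\<integral>t. g (h t) \<partial>N) + B)"
      using nonneg by (subst nn_integral_eq_integral[OF int]) (simp_all add: eq)
    show "0 \<le> (\<integral>t. g (h t) \<partial>N) + B"
      unfolding eq[symmetric] by (intro Bochner_Integration.integral_nonneg nonneg)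
  qed
  have h: "(\<lambda>t. fst (snd t)) \<in> borel_measurable family_law" "(\<lambda>t. snd (snd t)) \<in> borel_measurable family_law"
    by measurable
  have id: "(\<lambda>x. x) \<in> borel_measurable \<mu>" by measurable
  have "ennreal ((\<integral>t. g (fst (snd t)) \<partial>family_law) + B) + ennreal ((\<integral>t. g (snd (snd t)) \<partial>family_law) + B)
      = 2 * ennreal ((\<integral>x. g x \<partial>\<mu>) + B)"
    unfolding shift(1)[OF prob_space_family_law h(1), symmetric]
      shift(1)[OF prob_space_family_law h(2), symmetric]
      shift(1)[OF \<mu>.prob_space_axioms id, symmetric]
    by (rule nn_integral_daughters) measurable
  also have "2 * ennreal ((\<integral>x. g x \<partial>\<mu>) + B) = ennreal (2 * ((\<integral>x. g x \<partial>\<mu>) + B))"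
    using shift(2)[OF \<mu>.prob_space_axioms id] by (subst ennreal_mult) simp_all
  finally have "(\<integral>t. g (fst (snd t)) \<partial>family_law) + (\<integral>t. g (snd (snd t)) \<partial>family_law) = 2 * (\<integral>x. g x \<partial>\<mu>)"
    using shift(2)[OF prob_space_family_law h(1)] shift(2)[OF prob_space_family_law h(2)]
      shift(2)[OF \<mu>.prob_space_axioms id]
    by (subst (asm) ennreal_plus[symmetric]) (auto simp: ennreal_inj)
  moreover have "(\<integral>x. chain_op g x \<partial>\<mu>) = (\<integral>t. (g (fst (snd t)) + g (snd (snd t))) / 2 \<partial>family_law)"
    unfolding chain_op_def case_prod_beta
    by (rule integral_family_law[symmetric])
      (intro integrable_divide Bochner_Integration.integrable_add
        integrable_bounded_lipschitz[OF g prob_space_family_law] h)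
  moreover have "\<dots> = ((\<integral>t. g (fst (snd t)) \<partial>family_law) + (\<integral>t. g (snd (snd t)) \<partial>family_law)) / 2"
    using integrable_bounded_lipschitz[OF g prob_space_family_law h(1)]
      integrable_bounded_lipschitz[OF g prob_space_family_law h(2)] by simp
  ultimately show ?thesis by simp
qed

text \<open>\<open>G k\<close> is nearly constant near the origin, and the empirical first moments
  are bounded over all generations. Hence its average is close to the limit uniformly in
  \<open>q\<close>, and the shift by \<open>k\<close> carries this over to \<open>g\<close>.\<close>

theorem average_lipschitz_tendsto:
  fixes g :: "real \<Rightarrow> real"
  assumes g: "bounded_lipschitz g"
  shows "AE \<omega> in M. (\<lambda>q. average (generation q) g (\<lambda>i. X i \<omega>)) \<longlonglongrightarrow> (\<integral>x. g x \<partial>\<mu>)"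
proof -
  obtain B where B: "\<And>u. \<bar>g u\<bar> \<le> B"
    using g by (auto simp: bounded_lipschitz_def)
  obtain L where L: "L \<ge> 0" "\<And>u v. \<bar>g u - g v\<bar> \<le> L * \<bar>u - v\<bar>"
    using g by (auto simp: bounded_lipschitz_def dist_real_def)
  define G where "G k = (chain_op ^^ k) g" for k
  have G: "bounded_lipschitz (G k)" "\<bar>G k x\<bar> \<le> B" "\<bar>G k x - G k y\<bar> \<le> (L * rate ^ k) * \<bar>x - y\<bar>" for k x y
    unfolding G_def by (rule chain_op_iterate[OF g B L]; assumption)+
  have G_integral: "(\<integral>x. G k x \<partial>\<mu>) = (\<integral>x. g x \<partial>\<mu>)" for k
    by (induction k) (simp_all add: G_def integral_chain_op[OF G(1)[unfolded G_def]])
  have G_integrable: "integrable \<mu> (G k)" for k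
    using integrable_bounded_lipschitz[OF G(1) \<mu>.prob_space_axioms, of "\<lambda>x. x"] by simp
  have B_nonneg: "0 \<le> B" using B[of 0] by linarith
  have rate_lim: "(\<lambda>k. L * rate ^ k) \<longlonglongrightarrow> 0"
    using rate by (intro tendsto_mult_right_zero LIMSEQ_power_zero) auto
  \<comment> \<open>Without a first moment of \<open>\<mu>\<close> the Lipschitz bound cannot be
    integrated as it stands. The cutoff at \<open>2 * B\<close>, justified by the bound
    \<open>B\<close> on \<open>G k\<close>, lets dominated convergence give \<delta> tending to
    0.\<close>
  define \<delta> where "\<delta> k = (\<integral>y. min (2 * B) (L * rate ^ k * \<bar>y\<bar>) \<partial>\<mu>)" for k
  have \<delta>_integrable: "integrable \<mu> (\<lambda>y. min (2 * B) (L * rate ^ k * \<bar>y\<bar>))" for k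
    using B_nonneg L(1) rate(1) by (intro \<mu>.integrable_const_bound[of _ "2 * B"]) auto
  have \<delta>_lim: "\<delta> \<longlonglongrightarrow> 0"
  proof -
    have "(\<lambda>k. \<integral>y. min (2 * B) (L * rate ^ k * \<bar>y\<bar>) \<partial>\<mu>) \<longlonglongrightarrow> (\<integral>y. 0 \<partial>\<mu>)"
    proof (rule integral_dominated_convergence[where w = "\<lambda>_. 2 * B"])
      show "AE y in \<mu>. (\<lambda>k. min (2 * B) (L * rate ^ k * \<bar>y\<bar>)) \<longlonglongrightarrow> 0"
      proof (intro AE_I2)
        fix y
        have "(\<lambda>k. min (2 * B) (L * rate ^ k * \<bar>y\<bar>)) \<longlonglongrightarrow> min (2 * B) (0 * \<bar>y\<bar>)"
          by (intro tendsto_min tendsto_mult rate_lim tendsto_const)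
        then show "(\<lambda>k. min (2 * B) (L * rate ^ k * \<bar>y\<bar>)) \<longlonglongrightarrow> 0"
          using B_nonneg by simp
      qed
      show "AE y in \<mu>. norm (min (2 * B) (L * rate ^ k * \<bar>y\<bar>)) \<le> 2 * B" for k
        using B_nonneg L(1) rate(1) by (intro AE_I2) auto
    qed simp_all
    then show ?thesis by (simp add: \<delta>_def[abs_def])
  qed
  have G_close: "\<bar>G k x - (\<integral>y. g y \<partial>\<mu>)\<bar> \<le> L * rate ^ k * \<bar>x\<bar> + \<delta> k" for k x
  proof -
    have pointwise: "\<bar>G k x - G k y\<bar> \<le> L * rate ^ k * \<bar>x\<bar> + min (2 * B) (L * rate ^ k * \<bar>y\<bar>)" for y
    proof -
      have "0 \<le> L * rate ^ k" using L(1) rate(1) by simp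
      then have "L * rate ^ k * \<bar>x - y\<bar> \<le> L * rate ^ k * (\<bar>x\<bar> + \<bar>y\<bar>)" "0 \<le> L * rate ^ k * \<bar>x\<bar>"
        by (auto intro!: mult_left_mono)
      then have "\<bar>G k x - G k y\<bar> \<le> L * rate ^ k * \<bar>x\<bar> + L * rate ^ k * \<bar>y\<bar>"
        using G(3)[of k x y] by (simp add: distrib_left)
      moreover have "\<bar>G k x - G k y\<bar> \<le> L * rate ^ k * \<bar>x\<bar> + 2 * B"
        using G(2)[of k x] G(2)[of k y] \<open>0 \<le> L * rate ^ k * \<bar>x\<bar>\<close> by linarith
      ultimately show ?thesis
        unfolding min_add_distrib_right by (rule min.boundedI[rotated])
    qed
    \<comment> \<open>Invariance makes the limit the mean of \<open>G k\<close> itself, so the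
      difference is a mean of increments of \<open>G k\<close>.\<close>
    have "G k x - (\<integral>y. g y \<partial>\<mu>) = (\<integral>y. G k x - G k y \<partial>\<mu>)"
      using G_integrable[of k] by (simp add: G_integral \<mu>.prob_space)
    also have "\<bar>\<dots>\<bar> \<le> (\<integral>y. \<bar>G k x - G k y\<bar> \<partial>\<mu>)"
      by (rule integral_abs_bound)
    also have "\<dots> \<le> (\<integral>y. L * rate ^ k * \<bar>x\<bar> + min (2 * B) (L * rate ^ k * \<bar>y\<bar>) \<partial>\<mu>)"
      using G_integrable[of k] \<delta>_integrable[of k] pointwise by (intro integral_mono) simp_all
    also have "\<dots> = L * rate ^ k * \<bar>x\<bar> + \<delta> k"
      using \<delta>_integrable[of k] by (simp add: \<delta>_def \<mu>.prob_space)
    finally show ?thesis .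
  qed
  show ?thesis
    using average_generation_shift[OF g] X_moments_bounded
  proof eventually_elim
    case (elim \<omega>)
    define Z where "Z = (\<lambda>i. X i \<omega>)"
    have shift: "(\<lambda>q. average (generation (q + k)) g Z - average (generation q) (G k) Z) \<longlonglongrightarrow> 0" for k
      using elim(1) unfolding Z_def G_def by (rule spec)
    obtain K where K: "\<And>q. average (generation q) (\<lambda>x. \<bar>x\<bar> ^ 1) Z \<le> K"
      using spec[OF elim(2), of 1] unfolding Z_def by blast
    have nonempty: "generation q \<noteq> {}" for q
      by (simp add: generation_def)
    \<comment> \<open>Uniformity in \<open>q\<close> is what permits fixing \<open>k\<close> first
      and only then letting \<open>q\<close> tend to infinity.\<close>
    have average_close: "\<bar>average (generation q) (G k) Z - (\<integral>y. g y \<partial>\<mu>)\<bar> \<le> L * rate ^ k * K + \<delta> k" for k q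
    proof -
      have Lr: "0 \<le> L * rate ^ k" using L(1) rate(1) by simp
      have "average (generation q) (G k) Z \<le> average (generation q) (\<lambda>x. (L * rate ^ k * \<bar>x\<bar> ^ 1) + (\<delta> k + (\<integral>y. g y \<partial>\<mu>))) Z"
        using G_close[of k] by (intro average_mono) (smt (verit) power_one_right)
      moreover have "average (generation q) (\<lambda>x. - (L * rate ^ k) * \<bar>x\<bar> ^ 1 + ((\<integral>y. g y \<partial>\<mu>) - \<delta> k)) Z \<le> average (generation q) (G k) Z"
        using G_close[of k] by (intro average_mono) (smt (verit) power_one_right mult_minus_left)
      moreover have "L * rate ^ k * average (generation q) (\<lambda>x. \<bar>x\<bar> ^ 1) Z \<le> L * rate ^ k * K"
        by (intro mult_left_mono K Lr)
      ultimately show ?thesis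
        unfolding average_add average_cmult average_const[OF finite_generation nonempty]
      unfolding mult_minus_left by linarith
    qed
    have "(\<lambda>k. L * rate ^ k * K + \<delta> k) \<longlonglongrightarrow> 0 * K + 0"
      by (intro tendsto_add tendsto_mult rate_lim \<delta>_lim tendsto_const)
    then have small: "(\<lambda>k. L * rate ^ k * K + \<delta> k) \<longlonglongrightarrow> 0" by simp
    have "(\<lambda>q. average (generation q) g Z) \<longlonglongrightarrow> (\<integral>y. g y \<partial>\<mu>)"
    proof (rule LIMSEQ_I)
      fix e :: real assume "e > 0"
      then obtain k where k: "L * rate ^ k * K + \<delta> k < e / 2"
        using order_tendstoD(2)[OF small, of "e / 2"] by (auto simp: eventually_sequentially)
      obtain N where N: "\<And>q. q \<ge> N \<Longrightarrow> \<bar>average (generation (q + k)) g Z - average (generation q) (G k) Z\<bar> < e / 2"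
        using LIMSEQ_D[OF shift[of k], of "e / 2"] \<open>e > 0\<close> by auto
      have "\<bar>average (generation q) g Z - (\<integral>y. g y \<partial>\<mu>)\<bar> < e" if "q \<ge> N + k" for q
      proof -
        have "\<bar>average (generation q) g Z - average (generation (q - k)) (G k) Z\<bar> < e / 2"
          using N[of "q - k"] that by simp
        then show ?thesis using average_close[of "q - k" k] k by linarith
      qed
      then show "\<exists>no. \<forall>q\<ge>no. norm (average (generation q) g Z - (\<integral>y. g y \<partial>\<mu>)) < e"
        by (intro exI[of _ "N + k"]) simp
    qed
    then show ?case by (simp add: Z_def)
  qed
qed

lemma average_lipschitz_families_tendsto:
  assumes f: "bounded_lipschitz f"
  shows "AE \<omega> in M. (\<lambda>q. average (generation q) f (mother_daughters X \<omega>)) \<longlonglongrightarrow> (\<integral>t. f t \<partial>family_law)"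
proof -
  interpret T: prob_space family_law by (rule prob_space_family_law)
  have eq: "(\<integral>t. f t \<partial>family_law) = (\<integral>x. family_mean f x \<partial>\<mu>)"
    using integrable_bounded_lipschitz[OF f prob_space_family_law, of "\<lambda>t. t"]
    by (intro integral_family_law) simp
  show ?thesis
    using average_families_minus_means[OF f]
      average_lipschitz_tendsto[OF bounded_lipschitz_family_mean[OF f]]
  proof eventually_elim
    case (elim \<omega>)
    from tendsto_add[OF this] show ?case by (simp add: eq)
  qed
qed

text \<open>The coordinates of the families of generation \<open>q\<close> run through generations
  \<open>q\<close> and \<open>Suc q\<close>; there are two daughters per mother, whence the factor 2
  in front of the second average.\<close>

lemma norm_families_bounded:
  fixes m :: nat
  assumes "\<forall>k::nat. \<exists>K. \<forall>q. average (generation q) (\<lambda>x. \<bar>x\<bar> ^ k) (\<lambda>i. X i \<omega>) \<le> K"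
  shows "\<exists>K. \<forall>q. average (generation q) (\<lambda>t. norm t ^ m) (mother_daughters X \<omega>) \<le> K"
proof -
  obtain K where K: "\<And>q. average (generation q) (\<lambda>x. \<bar>x\<bar> ^ m) (\<lambda>i. X i \<omega>) \<le> K"
    using spec[OF assms, of m] by blast
  have norm_le: "norm t ^ m \<le> 2 ^ m * (\<bar>fst t\<bar> ^ m + 2 ^ m * (\<bar>fst (snd t)\<bar> ^ m + \<bar>snd (snd t)\<bar> ^ m))"
    for t :: "real \<times> real \<times> real"
  proof -
    have "norm t \<le> \<bar>fst t\<bar> + (\<bar>fst (snd t)\<bar> + \<bar>snd (snd t)\<bar>)"
      using norm_Pair_le[of "fst t" "snd t"] norm_Pair_le[of "fst (snd t)" "snd (snd t)"] by simp
    then have "norm t ^ m \<le> (\<bar>fst t\<bar> + (\<bar>fst (snd t)\<bar> + \<bar>snd (snd t)\<bar>)) ^ m"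
      by (intro power_mono) auto
    also have "\<dots> \<le> 2 ^ m * (\<bar>fst t\<bar> ^ m + (\<bar>fst (snd t)\<bar> + \<bar>snd (snd t)\<bar>) ^ m)"
      by (intro power_add_le) auto
    also have "\<dots> \<le> 2 ^ m * (\<bar>fst t\<bar> ^ m + 2 ^ m * (\<bar>fst (snd t)\<bar> ^ m + \<bar>snd (snd t)\<bar> ^ m))"
      by (intro mult_left_mono add_left_mono power_add_le) auto
    finally show ?thesis .
  qed
  let ?Z = "mother_daughters X \<omega>"
  have "average (generation q) (\<lambda>t. norm t ^ m) ?Z \<le> 2 ^ m * (K + 2 ^ m * (2 * K))" for q
  proof -
    have mothers: "average (generation q) (\<lambda>t. \<bar>fst t\<bar> ^ m) ?Z = average (generation q) (\<lambda>x. \<bar>x\<bar> ^ m) (\<lambda>i. X i \<omega>)"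
      by (simp add: average_def mother_daughters_def)
    have daughters: "average (generation q) (\<lambda>t. \<bar>fst (snd t)\<bar> ^ m + \<bar>snd (snd t)\<bar> ^ m) ?Z
        = 2 * average (generation (Suc q)) (\<lambda>x. \<bar>x\<bar> ^ m) (\<lambda>i. X i \<omega>)"
      unfolding average_generation sum_generation_Suc by (simp add: mother_daughters_def)
    have "average (generation q) (\<lambda>t. norm t ^ m) ?Z \<le> average (generation q)
        (\<lambda>t. 2 ^ m * (\<bar>fst t\<bar> ^ m + 2 ^ m * (\<bar>fst (snd t)\<bar> ^ m + \<bar>snd (snd t)\<bar> ^ m))) ?Z"
      by (rule average_mono) (rule norm_le)
    also have "\<dots> = 2 ^ m * (average (generation q) (\<lambda>x. \<bar>x\<bar> ^ m) (\<lambda>i. X i \<omega>)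
        + 2 ^ m * (2 * average (generation (Suc q)) (\<lambda>x. \<bar>x\<bar> ^ m) (\<lambda>i. X i \<omega>)))"
      unfolding average_cmult average_add[of "generation q" "\<lambda>t. \<bar>fst t\<bar> ^ m"] mothers daughters ..
    also have "\<dots> \<le> 2 ^ m * (K + 2 ^ m * (2 * K))"
      by (intro mult_left_mono add_mono K) auto
    finally show ?thesis .
  qed
  then show ?thesis by blast
qed

text \<open>The exceptional set is fixed by the countable family \<open>h\<close> and the countably
  many moment bounds, before \<open>f\<close> is introduced. For each remaining outcome the argument
  is deterministic.\<close>

theorem average_families_tendsto:
  "AE \<omega> in M. \<forall>f \<in> C_pol. (\<lambda>q. average (generation q) f (mother_daughters X \<omega>))
    \<longlonglongrightarrow> (\<integral>x. family_mean f x \<partial>\<mu>)"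
proof -
  obtain h :: "nat \<Rightarrow> real \<times> real \<times> real \<Rightarrow> real" where h: "\<forall>k. bounded_lipschitz (h k)" "\<forall>k x. 0 \<le> h k x"
    and approx: "\<forall>f. continuous_on UNIV f \<longrightarrow> (\<forall>x. 0 \<le> f x) \<longrightarrow>
       (\<exists>j::nat \<Rightarrow> nat. \<forall>x. incseq (\<lambda>n. h (j n) x) \<and> (\<lambda>n. h (j n) x) \<longlonglongrightarrow> f x)"
    using countable_approximation_from_below[where 'v = "real \<times> real \<times> real"] by (elim exE conjE) (rule that)
  have "AE \<omega> in M. \<forall>k. (\<lambda>q. average (generation q) (h k) (mother_daughters X \<omega>)) \<longlonglongrightarrow> (\<integral>t. h k t \<partial>family_law)"
    unfolding AE_all_countable using average_lipschitz_families_tendsto[OF spec[OF h(1)]] by (rule allI)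
  then show ?thesis
    using X_moments_bounded
  proof (eventually_elim, intro ballI)
    fix \<omega> and f :: "real \<times> real \<times> real \<Rightarrow> real"
    assume lim: "\<forall>k. (\<lambda>q. average (generation q) (h k) (mother_daughters X \<omega>)) \<longlonglongrightarrow> (\<integral>t. h k t \<partial>family_law)"
      and mom: "\<forall>k::nat. \<exists>K. \<forall>q. average (generation q) (\<lambda>x. \<bar>x\<bar> ^ k) (\<lambda>i. X i \<omega>) \<le> K"
      and f: "f \<in> C_pol"
    interpret converging_averages generation "mother_daughters X \<omega>" family_law h
    proof (rule converging_averages.intro)
      show "generation q \<noteq> {}" for q by (simp add: generation_def)
      show "prob_space family_law" by (rule prob_space_family_law)
      show "(\<lambda>q. average (generation q) (h k) (mother_daughters X \<omega>)) \<longlonglongrightarrow> (\<integral>t. h k t \<partial>family_law)" for k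
        using lim by (rule spec)
      show "\<exists>K. \<forall>q. average (generation q) (\<lambda>t. norm t ^ m) (mother_daughters X \<omega>) \<le> K" for m :: nat
        by (rule norm_families_bounded[OF mom])
      show "\<exists>j::nat \<Rightarrow> nat. \<forall>x. incseq (\<lambda>n. h (j n) x) \<and> (\<lambda>n. h (j n) x) \<longlonglongrightarrow> u x"
        if "continuous_on UNIV u" "\<And>x. 0 \<le> u x" for u
        using approx that by blast
    qed (simp_all add: h)
    \<comment> \<open>Integrability of \<open>f\<close> under the family law comes out of the moment
      bounds; it is what permits rewriting the limit by Fubini.\<close>
    show "(\<lambda>q. average (generation q) f (mother_daughters X \<omega>)) \<longlonglongrightarrow> (\<integral>x. family_mean f x \<partial>\<mu>)"
      using C_pol_average_tendsto[OF f] unfolding integral_family_law[OF C_pol_integrable[OF f]] .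
  qed
qed

lemma kernel_op_bar_P:
  assumes "f \<in> C_pol"
  shows "kernel_op (bar_P \<alpha>0 \<beta>0 \<alpha>1 \<beta>1 \<sigma> \<rho>) f x = family_mean f x"
proof -
  let ?c = "(\<alpha>0 * x + \<beta>0, \<alpha>1 * x + \<beta>1)"
  have cont: "continuous_on UNIV f" using assms by (simp add: C_pol_def)
  have "kernel_op (bar_P \<alpha>0 \<beta>0 \<alpha>1 \<beta>1 \<sigma> \<rho>) f x = (\<integral>p. f (x, p) \<partial>distr \<gamma> borel (\<lambda>p. ?c + p))"
  proof -
    have "(\<lambda>(y, z). f (x, y, z)) = (\<lambda>p. f (x, p))" by auto
    then show ?thesis by (simp add: kernel_op_def bar_P_def distr_gauss2_shift)
  qed
  also have "\<dots> = (\<integral>p. f (x, ?c + p) \<partial>\<gamma>)"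
  proof (rule integral_distr)
    show "(\<lambda>p. f (x, p)) \<in> borel_measurable borel"
      by (intro borel_measurable_continuous_onI continuous_on_compose2[OF cont]) (auto intro!: continuous_intros)
  qed simp
  also have "\<dots> = family_mean f x"
    unfolding family_mean_def family_map_def
    by (intro arg_cong[where f = "integral\<^sup>L \<gamma>"] ext) (simp add: plus_prod_def)
  finally show ?thesis .
qed

text \<open>Through functions of the mother alone, the convergence for families contains that for
  single vertices.\<close>

lemma C_pol_mother:
  assumes "f \<in> C_pol"
  shows "(\<lambda>t::real \<times> real \<times> real. f (fst t)) \<in> C_pol"
proof -
  obtain c m where c: "c \<ge> 0" "\<And>x. \<bar>f x\<bar> \<le> c * (1 + norm x ^ m)" and cont: "continuous_on UNIV f"
    using assms by (auto simp: C_pol_def)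
  have "\<bar>f (fst t)\<bar> \<le> c * (1 + norm t ^ m)" for t :: "real \<times> real \<times> real"
  proof -
    have "c * (1 + norm (fst t) ^ m) \<le> c * (1 + norm t ^ m)"
      using c(1) norm_fst_le[of "fst t" "snd t"] by (intro mult_left_mono add_left_mono power_mono) auto
    with c(2)[of "fst t"] show ?thesis by (rule order_trans)
  qed
  moreover have "continuous_on UNIV (\<lambda>t::real \<times> real \<times> real. f (fst t))"
    by (intro continuous_on_compose2[OF cont]) (auto intro!: continuous_intros)
  ultimately show ?thesis
    unfolding C_pol_def using c(1) by (intro CollectI conjI exI[of _ c] exI[of _ m] allI)
qed

lemma family_mean_mother: "family_mean (\<lambda>t. f (fst t)) = f"
proof -
  interpret g: prob_space \<gamma> by (rule prob_space_\<gamma>)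
  show ?thesis using g.prob_space by (simp add: family_mean_def[abs_def] family_map_def)
qed

end

theorem proposition28:
  fixes M :: "'a measure"
    and X \<epsilon> :: "nat \<Rightarrow> 'a \<Rightarrow> real"
    and \<nu> \<mu> :: "real measure"
    and \<alpha>0 \<beta>0 \<alpha>1 \<beta>1 \<sigma> \<rho> :: real
  assumes "bar_model M X \<epsilon> \<nu> \<alpha>0 \<beta>0 \<alpha>1 \<beta>1 \<sigma> \<rho>"
    and "\<And>k::nat. integrable \<nu> (\<lambda>x. \<bar>x\<bar> ^ k)"
    and "stationary_distribution (bar_Q \<alpha>0 \<beta>0 \<alpha>1 \<beta>1 \<sigma>) \<mu>"
  shows "(AE \<omega> in M. \<forall>f \<in> (C_pol :: (real \<Rightarrow> real) set).
           (\<lambda>q. average (generation q) f (\<lambda>i. X i \<omega>)) \<longlonglongrightarrow> (\<integral>x. f x \<partial>\<mu>) \<and>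
           (\<lambda>r. average (tree_upto r) f (\<lambda>i. X i \<omega>)) \<longlonglongrightarrow> (\<integral>x. f x \<partial>\<mu>)) \<and>
         (AE \<omega> in M. \<forall>f \<in> (C_pol :: (real \<times> real \<times> real \<Rightarrow> real) set).
           (\<lambda>q. average (generation q) f (mother_daughters X \<omega>)) \<longlonglongrightarrow>
             (\<integral>x. kernel_op (bar_P \<alpha>0 \<beta>0 \<alpha>1 \<beta>1 \<sigma> \<rho>) f x \<partial>\<mu>) \<and>
           (\<lambda>r. average (tree_upto r) f (mother_daughters X \<omega>)) \<longlonglongrightarrow>
             (\<integral>x. kernel_op (bar_P \<alpha>0 \<beta>0 \<alpha>1 \<beta>1 \<sigma> \<rho>) f x \<partial>\<mu>))"
proof -
  interpret bar_model M X \<epsilon> \<nu> \<alpha>0 \<beta>0 \<alpha>1 \<beta>1 \<sigma> \<rho> by fact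
  interpret stationary_bar_model M X \<epsilon> \<nu> \<alpha>0 \<beta>0 \<alpha>1 \<beta>1 \<sigma> \<rho> \<mu>
    by unfold_locales fact
  show ?thesis
  proof
    show "AE \<omega> in M. \<forall>f \<in> (C_pol :: (real \<Rightarrow> real) set).
           (\<lambda>q. average (generation q) f (\<lambda>i. X i \<omega>)) \<longlonglongrightarrow> (\<integral>x. f x \<partial>\<mu>) \<and>
           (\<lambda>r. average (tree_upto r) f (\<lambda>i. X i \<omega>)) \<longlonglongrightarrow> (\<integral>x. f x \<partial>\<mu>)"
      using average_families_tendsto
    proof (eventually_elim, intro ballI)
      fix \<omega> and f :: "real \<Rightarrow> real"
      assume lim: "\<forall>f \<in> C_pol. (\<lambda>q. average (generation q) f (mother_daughters X \<omega>))
          \<longlonglongrightarrow> (\<integral>x. family_mean f x \<partial>\<mu>)" and f: "f \<in> C_pol"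
      have "average I (\<lambda>t. f (fst t)) (mother_daughters X \<omega>) = average I f (\<lambda>i. X i \<omega>)" for I
        by (simp add: average_def mother_daughters_def)
      with bspec[OF lim C_pol_mother[OF f]]
      have "(\<lambda>q. average (generation q) f (\<lambda>i. X i \<omega>)) \<longlonglongrightarrow> (\<integral>x. f x \<partial>\<mu>)"
        by (simp add: family_mean_mother)
      then show "(\<lambda>q. average (generation q) f (\<lambda>i. X i \<omega>)) \<longlonglongrightarrow> (\<integral>x. f x \<partial>\<mu>) \<and>
           (\<lambda>r. average (tree_upto r) f (\<lambda>i. X i \<omega>)) \<longlonglongrightarrow> (\<integral>x. f x \<partial>\<mu>)"
        by (blast intro: average_tree_upto_tendsto)
    qed
    show "AE \<omega> in M. \<forall>f \<in> (C_pol :: (real \<times> real \<times> real \<Rightarrow> real) set).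
           (\<lambda>q. average (generation q) f (mother_daughters X \<omega>)) \<longlonglongrightarrow>
             (\<integral>x. kernel_op (bar_P \<alpha>0 \<beta>0 \<alpha>1 \<beta>1 \<sigma> \<rho>) f x \<partial>\<mu>) \<and>
           (\<lambda>r. average (tree_upto r) f (mother_daughters X \<omega>)) \<longlonglongrightarrow>
             (\<integral>x. kernel_op (bar_P \<alpha>0 \<beta>0 \<alpha>1 \<beta>1 \<sigma> \<rho>) f x \<partial>\<mu>)"
      using average_families_tendsto
    proof (eventually_elim, intro ballI conjI)
      fix \<omega> and f :: "real \<times> real \<times> real \<Rightarrow> real"
      assume lim: "\<forall>f \<in> C_pol. (\<lambda>q. average (generation q) f (mother_daughters X \<omega>))
          \<longlonglongrightarrow> (\<integral>x. family_mean f x \<partial>\<mu>)" and f: "f \<in> C_pol"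
      show "(\<lambda>q. average (generation q) f (mother_daughters X \<omega>)) \<longlonglongrightarrow>
             (\<integral>x. kernel_op (bar_P \<alpha>0 \<beta>0 \<alpha>1 \<beta>1 \<sigma> \<rho>) f x \<partial>\<mu>)"
        using bspec[OF lim f] by (simp add: kernel_op_bar_P[OF f])
      then show "(\<lambda>r. average (tree_upto r) f (mother_daughters X \<omega>)) \<longlonglongrightarrow>
             (\<integral>x. kernel_op (bar_P \<alpha>0 \<beta>0 \<alpha>1 \<beta>1 \<sigma> \<rho>) f x \<partial>\<mu>)"
        by (rule average_tree_upto_tendsto)
    qed
  qed
qed

end
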